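(* Let $p\geq 2$ and let $G$ be a finite simple $\{pK_2, \mathrm{gem}^+\}$-free graph. Then $\chi(G)\leq f_p(\omega(G))$, where $f_p:\mathbb{N}\to\mathbb{N}$ ($p\geq2$) is defined by: $f_t(1)=1$ for $t\geq2$; $f_2(2)=3$; $f_2(3)=4$; $f_2(s)=\binom{s+1}{2}$ for $s\geq 4$; $f_p(2)=2p-2$ for $p\geq 3$; and $f_p(m)=f_{p-1}(m)+\binom{m+1}{2}+m-2$ for $m,p\geq 3$.
   Context: $\chi(G)$ is the chromatic number and $\omega(G)$ the clique number of $G$. $pK_2$ is the disjoint union of $p$ edges. $\mathrm{gem}^+$ is the graph on six vertices $K_1+(P_4\cup K_1)$: a vertex adjacent to all vertices of a path $P_4$ and to one further vertex, the latter having no other neighbours (i.e. a gem with a pendant vertex attached to its dominating vertex). A graph is $\mathcal{F}$-free if it has no induced subgraph isomorphic to a member of $\mathcal{F}$. *)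

theory Defs
  imports "Graph_Theory.Graph_Theory"
begin

text \<open>A finite simple graph is a \<^const>\<open>pair_graph\<close>: a finite vertex set with a symmetric,
  irreflexive set of ordered pairs, so each edge $uv$ is stored as both $(u,v)$ and $(v,u)$.\<close>

definition proper_coloring :: "'a pair_pre_digraph \<Rightarrow> nat \<Rightarrow> ('a \<Rightarrow> nat) \<Rightarrow> bool" where
  "proper_coloring G k c \<longleftrightarrow>
     c ` pverts G \<subseteq> {..<k} \<and> (\<forall>(u, v) \<in> parcs G. c u \<noteq> c v)"

definition chromatic_number :: "'a pair_pre_digraph \<Rightarrow> nat" where
  "chromatic_number G = (LEAST k. \<exists>c. proper_coloring G k c)"

definition is_clique :: "'a pair_pre_digraph \<Rightarrow> 'a set \<Rightarrow> bool" where
  "is_clique G K \<longleftrightarrow> K \<subseteq> pverts G \<and> pairwise (\<lambda>u v. (u, v) \<in> parcs G) K"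

definition clique_number :: "'a pair_pre_digraph \<Rightarrow> nat" where
  "clique_number G = Max (card ` {K. is_clique G K})"

definition free_of :: "'b pair_pre_digraph set \<Rightarrow> 'a pair_pre_digraph \<Rightarrow> bool" where
  "free_of \<F> G \<longleftrightarrow>
     \<not> (\<exists>F \<in> \<F>. \<exists>H. induced_subgraph H (with_proj G) \<and> digraph_iso H (with_proj F))"

definition disjoint_edges :: "nat \<Rightarrow> nat pair_pre_digraph" where
  "disjoint_edges p =
     \<lparr> pverts = {..<2 * p}, parcs = symcl ((\<lambda>i. (2 * i, 2 * i + 1)) ` {..<p}) \<rparr>"

text \<open>0 is the dominating vertex, 1-2-3-4 the path, and 5 the pendant vertex.\<close>

definition gem_plus :: "nat pair_pre_digraph" where
  "gem_plus =
     \<lparr> pverts = {0, 1, 2, 3, 4, 5},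
       parcs = symcl {(1, 2), (2, 3), (3, 4), (0, 1), (0, 2), (0, 3), (0, 4), (0, 5)} \<rparr>"

text \<open>The value 0 outside the intended domain (first argument at least 2, second at least 1)
  is a convention; a second argument 0 arises only for the graph without vertices.\<close>

fun chi_bound :: "nat \<Rightarrow> nat \<Rightarrow> nat" where
  "chi_bound p m =
     (if p < 2 \<or> m = 0 then 0
      else if m = 1 then 1
      else if p = 2 then (if m = 2 then 3 else if m = 3 then 4 else (m + 1) choose 2)
      else if m = 2 then 2 * p - 2
      else chi_bound (p - 1) m + ((m + 1) choose 2) + m - 2)"

declare chi_bound.simps [simp del]

lemma chi_bound_eqs:
  "2 \<le> t \<Longrightarrow> chi_bound t 1 = 1"
  "chi_bound 2 2 = 3"
  "chi_bound 2 3 = 4"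
  "4 \<le> s \<Longrightarrow> chi_bound 2 s = (s + 1) choose 2"
  "3 \<le> p \<Longrightarrow> chi_bound p 2 = 2 * p - 2"
  "3 \<le> m \<Longrightarrow> 3 \<le> p \<Longrightarrow> chi_bound p m = chi_bound (p - 1) m + ((m + 1) choose 2) + m - 2"
  by (simp_all add: chi_bound.simps[of t] chi_bound.simps[of 2] chi_bound.simps[of p]
        del: One_nat_def)

lemma pair_graph_disjoint_edges: "pair_graph (disjoint_edges p)"
  by unfold_locales
    (auto simp: disjoint_edges_def symcl_def symmetric_def arcs_ends_conv with_proj_def sym_def)

lemma pair_graph_gem_plus: "pair_graph gem_plus"
  by unfold_locales
    (auto simp: gem_plus_def symcl_def symmetric_def arcs_ends_conv with_proj_def sym_def)

lemma free_of_iff_embedding: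
  assumes G: "pair_graph G" and \<F>: "\<And>F. F \<in> \<F> \<Longrightarrow> pair_graph F"
  shows "free_of \<F> G \<longleftrightarrow>
    \<not> (\<exists>F \<in> \<F>. \<exists>f. inj_on f (pverts F) \<and> f ` pverts F \<subseteq> pverts G \<and>
        (\<forall>u \<in> pverts F. \<forall>v \<in> pverts F. (f u, f v) \<in> parcs G \<longleftrightarrow> (u, v) \<in> parcs F))"
proof -
  interpret G: pair_graph G by (rule G)
  have "(\<exists>H. induced_subgraph H (with_proj G) \<and> digraph_iso H (with_proj F)) \<longleftrightarrow>
     (\<exists>f. inj_on f (pverts F) \<and> f ` pverts F \<subseteq> pverts G \<and>
        (\<forall>u \<in> pverts F. \<forall>v \<in> pverts F. (f u, f v) \<in> parcs G \<longleftrightarrow> (u, v) \<in> parcs F))"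
    (is "?L \<longleftrightarrow> ?R") if "F \<in> \<F>" for F
  proof
    interpret F: pair_graph F by (rule \<F>[OF that])
    {
      assume ?L
      then obtain H h where H: "induced_subgraph H (with_proj G)"
        and h: "pre_digraph.digraph_isomorphism H h" "with_proj F = app_iso h H"
        unfolding digraph_iso_def by blast
      let ?g = "iso_verts h"
      have th: "tail H = fst" "head H = snd" and VH: "verts H \<subseteq> pverts G"
        and AH: "arcs H = {e \<in> parcs G. fst e \<in> verts H \<and> snd e \<in> verts H}"
        using H by (auto simp: induced_subgraph_def subgraph_def compatible_def)
      have inj: "inj_on ?g (verts H)"
        and ends: "\<And>a. a \<in> arcs H \<Longrightarrow> ?g (fst a) = fst (iso_arcs h a) \<and> ?g (snd a) = snd (iso_arcs h a)"
        using h th by (auto simp: pre_digraph.digraph_isomorphism_def app_iso_def with_proj_def)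
      have VF: "pverts F = ?g ` verts H" and AF: "parcs F = iso_arcs h ` arcs H"
        using h(2) by (auto simp: app_iso_def with_proj_def)
      have ia: "iso_arcs h a = (?g (fst a), ?g (snd a))" if "a \<in> arcs H" for a
        using ends[OF that] by (simp add: prod_eq_iff)
      have iff: "(?g x, ?g y) \<in> parcs F \<longleftrightarrow> (x, y) \<in> parcs G" if xy: "x \<in> verts H" "y \<in> verts H" for x y
      proof
        assume "(?g x, ?g y) \<in> parcs F"
        then obtain a where a: "a \<in> arcs H" "(?g x, ?g y) = iso_arcs h a" using AF by auto
        then have "x = fst a" "y = snd a"
          using ia[OF a(1)] inj xy AH by (auto simp: inj_on_def)
        then show "(x, y) \<in> parcs G" using a(1) AH by simp
      next
        assume "(x, y) \<in> parcs G"
        then have "(x, y) \<in> arcs H" using AH xy by simp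
        then show "(?g x, ?g y) \<in> parcs F" using ia[of "(x, y)"] AF by force
      qed
      let ?f = "the_inv_into (verts H) ?g"
      have f: "?f u \<in> verts H \<and> ?g (?f u) = u" if "u \<in> pverts F" for u
        using that inj VF by (auto simp: the_inv_into_f_f)
      show ?R
      proof (intro exI[of _ ?f] conjI ballI)
        show "inj_on ?f (pverts F)" using f by (metis inj_onI)
        show "?f ` pverts F \<subseteq> pverts G" using f VH by blast
        show "(?f u, ?f v) \<in> parcs G \<longleftrightarrow> (u, v) \<in> parcs F" if "u \<in> pverts F" "v \<in> pverts F" for u v
          using iff[of "?f u" "?f v"] f that by auto
      qed
    next
      assume ?R
      then obtain f where inj: "inj_on f (pverts F)" and sub: "f ` pverts F \<subseteq> pverts G"
        and iff: "\<And>u v. u \<in> pverts F \<Longrightarrow> v \<in> pverts F \<Longrightarrow> (f u, f v) \<in> parcs G \<longleftrightarrow> (u, v) \<in> parcs F"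
        by blast
      let ?H = "with_proj G \<restriction> (f ` pverts F)"
      let ?g = "the_inv_into (pverts F) f"
      let ?h = "\<lparr> iso_verts = ?g, iso_arcs = map_prod ?g ?g, iso_head = snd, iso_tail = fst \<rparr>"
      have gf: "?g (f u) = u" if "u \<in> pverts F" for u using inj that by (rule the_inv_into_f_f)
      have ig: "inj_on ?g (f ` pverts F)" using gf by (auto simp: inj_on_def)
      have wfH: "wf_digraph ?H" by (rule G.wellformed_induce_subgraph)
      have 1: "induced_subgraph ?H (with_proj G)" using sub by (intro G.induced_induce) auto
      have "inj_on (map_prod ?g ?g) (arcs ?H)"
        using gf by (auto simp: inj_on_def)
      then have 2: "pre_digraph.digraph_isomorphism ?H ?h"
        using ig wfH by (auto simp: pre_digraph.digraph_isomorphism_def)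
      have "parcs F = map_prod ?g ?g ` arcs ?H"
      proof (intro equalityI subsetI)
        fix e assume e: "e \<in> parcs F"
        obtain u v where uv: "e = (u, v)" by (cases e)
        have "u \<in> pverts F" "v \<in> pverts F" using e uv F.wellformed' by auto
        then show "e \<in> map_prod ?g ?g ` arcs ?H"
          using e uv iff gf by (intro image_eqI[of _ _ "(f u, f v)"]) auto
      next
        fix e assume "e \<in> map_prod ?g ?g ` arcs ?H"
        then show "e \<in> parcs F" using iff gf by auto
      qed
      moreover have "pverts F = ?g ` f ` pverts F" using gf by (auto simp: image_iff)
      ultimately have "with_proj F = app_iso ?h ?H" by (simp add: app_iso_def with_proj_def)
      then show ?L using 1 2 unfolding digraph_iso_def by blast
    }
  qed
  then show ?thesis unfolding free_of_def by (simp only: cong: bex_cong)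
qed

end

theory Submission
  imports Defs
begin

text \<open>
  Let \<open>uv\<close> be an edge of a graph \<open>G\<close> with clique number \<open>m\<close>. The vertex \<open>v\<close> has no neighbour in
  \<open>N(u) - N[v]\<close>, so a \<open>P\<^sub>4\<close> there would form a \<open>gem\<^sup>+\<close> together with \<open>u\<close> and \<open>v\<close>; hence \<open>N(u) - N(v)\<close>
  and \<open>N(v) - N(u)\<close> are \<open>P\<^sub>4\<close>-free and need at most \<open>m - 1\<close> colours each. The common
  neighbourhood is \<open>(P\<^sub>4 \<union> K\<^sub>1)\<close>-free with clique number at most \<open>m - 2\<close>, and splitting it repeatedly into
  neighbours and non-neighbours of a vertex colours it with \<open>m - 1\<close> choose 2 colours. The
  common non-neighbours contain no induced \<open>(p - 1)K\<^sub>2\<close>, which gives an induction on \<open>p\<close>.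

  Two cases need sharper bounds. For \<open>2K\<^sub>2\<close>-free graphs with \<open>m = 3\<close>, consider the complement,
  which contains no \<open>C\<^sub>4\<close>, no stable set of size four and no disjoint union of a gem and a vertex.
  It is covered by four cliques: if it has no induced \<open>P\<^sub>5\<close>, take three pairwise non-adjacent
  vertices, the private neighbourhood of each of them, and the vertices adjacent to at least two
  of them; if it has an induced \<open>P\<^sub>5\<close> or \<open>C\<^sub>5\<close>, possibly with one or two vertices attached to the
  \<open>C\<^sub>5\<close>, the cliques are read off from the adjacencies to that configuration. In a triangle-free
  graph without \<open>3K\<^sub>2\<close>, the non-neighbours of an edge \<open>xy\<close> are bipartite, or they form a blow-up
  of \<open>C\<^sub>5\<close> with isolated vertices. In the second case four colours suffice unless \<open>x\<close> and \<open>y\<close> have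
  neighbours seeing several pairs of classes of the blow-up, and these neighbours produce a
  \<open>3K\<^sub>2\<close>.
\<close>

section \<open>Colourings and cliques\<close>

definition stable_set :: "('a \<Rightarrow> 'a \<Rightarrow> bool) \<Rightarrow> 'a set \<Rightarrow> bool" where
  "stable_set E S \<longleftrightarrow> (\<forall>u \<in> S. \<forall>v \<in> S. \<not> E u v)"

definition colorable :: "('a \<Rightarrow> 'a \<Rightarrow> bool) \<Rightarrow> 'a set \<Rightarrow> nat \<Rightarrow> bool" where
  "colorable E V k \<longleftrightarrow>
     (\<exists>c :: 'a \<Rightarrow> nat. (\<forall>v \<in> V. c v < k) \<and> (\<forall>u \<in> V. \<forall>v \<in> V. E u v \<longrightarrow> c u \<noteq> c v))"

definition cliques_le :: "('a \<Rightarrow> 'a \<Rightarrow> bool) \<Rightarrow> 'a set \<Rightarrow> nat \<Rightarrow> bool" where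
  "cliques_le E V m \<longleftrightarrow> (\<forall>K \<subseteq> V. pairwise E K \<longrightarrow> card K \<le> m)"

definition induced :: "('a \<Rightarrow> 'a \<Rightarrow> bool) \<Rightarrow> 'a set \<Rightarrow> 'a \<Rightarrow> 'a \<Rightarrow> bool" where
  "induced E V u v \<longleftrightarrow> u \<in> V \<and> v \<in> V \<and> E u v"

text \<open>In the following conditions the listed adjacencies and non-adjacencies force the vertices
  to be distinct.\<close>

definition P4_free :: "('a \<Rightarrow> 'a \<Rightarrow> bool) \<Rightarrow> 'a set \<Rightarrow> bool" where
  "P4_free E V \<longleftrightarrow> (\<forall>a \<in> V. \<forall>b \<in> V. \<forall>c \<in> V. \<forall>d \<in> V.
     E a b \<longrightarrow> E b c \<longrightarrow> E c d \<longrightarrow> E a c \<or> E a d \<or> E b d)"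

definition P4_plus_K1_free :: "('a \<Rightarrow> 'a \<Rightarrow> bool) \<Rightarrow> 'a set \<Rightarrow> bool" where
  "P4_plus_K1_free E V \<longleftrightarrow> (\<forall>v \<in> V. P4_free E {w \<in> V. \<not> E v w})"

definition gem_plus_free :: "('a \<Rightarrow> 'a \<Rightarrow> bool) \<Rightarrow> 'a set \<Rightarrow> bool" where
  "gem_plus_free E V \<longleftrightarrow> (\<forall>v \<in> V. P4_plus_K1_free E {w \<in> V. E v w})"

definition has_induced_matching :: "('a \<Rightarrow> 'a \<Rightarrow> bool) \<Rightarrow> 'a set \<Rightarrow> nat \<Rightarrow> bool" where
  "has_induced_matching E V p \<longleftrightarrow> (\<exists>h :: nat \<Rightarrow> 'a. (\<forall>m < 2 * p. h m \<in> V) \<and>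
     (\<forall>m < 2 * p. \<forall>n < 2 * p. E (h m) (h n) \<longleftrightarrow> m div 2 = n div 2 \<and> m \<noteq> n))"

lemma colorable_mono:
  assumes "colorable E V k" "W \<subseteq> V" "k \<le> l"
  shows "colorable E W l"
  using assms unfolding colorable_def by (meson order_less_le_trans subsetD)

lemma colorable_Un:
  assumes "colorable E V k" "colorable E W l"
  shows "colorable E (V \<union> W) (k + l)"
proof -
  obtain c d where c: "\<forall>v \<in> V. c v < k" "\<forall>u \<in> V. \<forall>v \<in> V. E u v \<longrightarrow> c u \<noteq> c v"
    and d: "\<forall>v \<in> W. d v < l" "\<forall>u \<in> W. \<forall>v \<in> W. E u v \<longrightarrow> d u \<noteq> d v"
    using assms unfolding colorable_def by blast
  let ?c = "\<lambda>v. if v \<in> V then c v else k + d v"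
  have "\<forall>v \<in> V \<union> W. ?c v < k + l" using c(1) d(1) by (auto intro: trans_less_add1)
  moreover have "?c u \<noteq> ?c v" if "u \<in> V \<union> W" "v \<in> V \<union> W" "E u v" for u v
    using that c d by (cases "u \<in> V"; cases "v \<in> V") force+
  ultimately show ?thesis unfolding colorable_def by (intro exI[of _ ?c]) blast
qed

lemma colorable_empty: "colorable E {} k"
  by (simp add: colorable_def)

lemma colorable_stable: "stable_set E S \<Longrightarrow> colorable E S 1"
  unfolding colorable_def stable_set_def by (intro exI[of _ "\<lambda>_. 0"]) auto

lemma colorable_induced: "colorable (induced E V) UNIV k \<Longrightarrow> colorable E V k"
  unfolding colorable_def induced_def by blast

lemma colorable_4I:
  assumes "\<And>v. v \<in> V \<Longrightarrow> A v \<or> B v \<or> C v \<or> D v"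
    and "\<And>u v. A u \<Longrightarrow> A v \<Longrightarrow> \<not> E u v" "\<And>u v. B u \<Longrightarrow> B v \<Longrightarrow> \<not> E u v"
    and "\<And>u v. C u \<Longrightarrow> C v \<Longrightarrow> \<not> E u v" "\<And>u v. D u \<Longrightarrow> D v \<Longrightarrow> \<not> E u v"
  shows "colorable E V 4"
proof -
  have "colorable E {v. A v} 1" "colorable E {v. B v} 1" "colorable E {v. C v} 1" "colorable E {v. D v} 1"
    by (rule colorable_stable; use assms(2-5) in \<open>simp add: stable_set_def\<close>)+
  then have "colorable E (({v. A v} \<union> {v. B v}) \<union> ({v. C v} \<union> {v. D v})) ((1 + 1) + (1 + 1))"
    by (intro colorable_Un)
  then show ?thesis by (rule colorable_mono) (use assms(1) in auto)
qed

lemma cliques_le_subset: "cliques_le E V m \<Longrightarrow> W \<subseteq> V \<Longrightarrow> cliques_le E W m"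
  unfolding cliques_le_def by blast

lemma cliques_le_0D:
  assumes "cliques_le E V 0"
  shows "V = {}"
proof -
  have "pairwise E {v} \<longrightarrow> card {v} \<le> 0" if "v \<in> V" for v
    using assms that unfolding cliques_le_def by blast
  then show ?thesis by auto
qed

lemma P4_free_subset: "P4_free E V \<Longrightarrow> W \<subseteq> V \<Longrightarrow> P4_free E W"
  unfolding P4_free_def by blast

lemma P4_plus_K1_free_subset:
  assumes "P4_plus_K1_free E V" "W \<subseteq> V"
  shows "P4_plus_K1_free E W"
  unfolding P4_plus_K1_free_def
proof
  fix v assume "v \<in> W"
  then have "P4_free E {w \<in> V. \<not> E v w}" using assms unfolding P4_plus_K1_free_def by blast
  then show "P4_free E {w \<in> W. \<not> E v w}" by (rule P4_free_subset) (use assms(2) in blast)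
qed

lemma gem_plus_free_subset:
  assumes "gem_plus_free E V" "W \<subseteq> V"
  shows "gem_plus_free E W"
  unfolding gem_plus_free_def
proof
  fix v assume "v \<in> W"
  then have "P4_plus_K1_free E {w \<in> V. E v w}" using assms unfolding gem_plus_free_def by blast
  then show "P4_plus_K1_free E {w \<in> W. E v w}" by (rule P4_plus_K1_free_subset) (use assms(2) in blast)
qed

lemma obtain_dominating_stable:
  assumes "finite V"
  obtains S where "S \<subseteq> V" "stable_set E S" "\<And>v. v \<in> V - S \<Longrightarrow> E v v \<or> (\<exists>s \<in> S. E v s \<or> E s v)"
proof -
  let ?st = "{S. S \<subseteq> V \<and> stable_set E S}"
  have "finite ?st" by (rule finite_subset[of _ "Pow V"]) (use assms in auto)
  moreover have "{} \<in> ?st" by (simp add: stable_set_def)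
  ultimately obtain S where S: "S \<in> ?st" and max: "\<And>T. T \<in> ?st \<Longrightarrow> S \<subseteq> T \<Longrightarrow> S = T"
    using finite_has_maximal[of ?st] by auto
  show thesis
  proof (rule that[of S])
    show "S \<subseteq> V" "stable_set E S" using S by auto
    show "E v v \<or> (\<exists>s \<in> S. E v s \<or> E s v)" if v: "v \<in> V - S" for v
    proof (rule ccontr)
      assume "\<not> ?thesis"
      then have "insert v S \<in> ?st" using S v by (auto simp: stable_set_def)
      then show False using max[of "insert v S"] v by blast
    qed
  qed
qed

locale ugraph =
  fixes E :: "'a \<Rightarrow> 'a \<Rightarrow> bool"
  assumes sym: "E u v \<Longrightarrow> E v u" and irrefl: "\<not> E u u"
begin

lemma cliques_le_neighbours:
  assumes "finite V" "v \<in> V" "cliques_le E V (Suc m)"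
  shows "cliques_le E {w \<in> V. E v w} m"
  unfolding cliques_le_def
proof (intro allI impI)
  fix K assume K: "K \<subseteq> {w \<in> V. E v w}" "pairwise E K"
  then have "pairwise E (insert v K)" using sym by (auto simp: pairwise_insert)
  moreover have "insert v K \<subseteq> V" "v \<notin> K" "finite K"
    using K assms(1,2) irrefl by (auto intro: finite_subset)
  ultimately show "card K \<le> m" using assms(3) unfolding cliques_le_def
    by (metis Suc_le_mono card_insert_disjoint)
qed

lemma length_le_if_sorted_wrt:
  assumes "cliques_le E V m" "sorted_wrt E xs" "set xs \<subseteq> V"
  shows "length xs \<le> m"
proof -
  have "distinct xs \<and> pairwise E (set xs)"
    using assms(2) by (induction xs) (auto simp: pairwise_insert irrefl sym)
  then show ?thesis using assms(1,3) distinct_card[of xs] unfolding cliques_le_def by metis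
qed

lemma cliques_le_2I:
  assumes "\<And>a b c. a \<in> V \<Longrightarrow> b \<in> V \<Longrightarrow> c \<in> V \<Longrightarrow> E a b \<Longrightarrow> E a c \<Longrightarrow> E b c \<Longrightarrow> False"
  shows "cliques_le E V 2"
  unfolding cliques_le_def
proof (intro allI impI, rule ccontr)
  fix K assume K: "K \<subseteq> V" "pairwise E K" "\<not> card K \<le> 2"
  then have "3 \<le> card K" by simp
  then obtain T where "T \<subseteq> K" "card T = 3" by (rule obtain_subset_with_card_n)
  then obtain a b c where "{a, b, c} \<subseteq> K" "a \<noteq> b" "a \<noteq> c" "b \<noteq> c" by (auto simp: card_3_iff)
  then show False using assms[of a b c] K(1,2) by (auto simp: pairwise_def)
qed

lemma P4_free_stable_extends_clique:
  assumes "P4_free E V" "S \<subseteq> V" "stable_set E S" "K \<subseteq> V" "finite K" "pairwise E K" "K \<noteq> {}"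
    and dom: "\<And>k. k \<in> K \<Longrightarrow> \<exists>s \<in> S. E k s"
  shows "\<exists>s \<in> S. \<forall>k \<in> K. E s k"
proof -
  let ?N = "\<lambda>s. {k \<in> K. E s k}"
  have "finite (?N ` S)" by (rule finite_subset[of _ "Pow K"]) (use assms(5) in auto)
  moreover have "?N ` S \<noteq> {}" using dom assms(7) by blast
  ultimately obtain A where "A \<in> ?N ` S" "\<forall>B \<in> ?N ` S. A \<subseteq> B \<longrightarrow> A = B"
    using finite_has_maximal[of "?N ` S"] by auto
  then obtain s where s: "s \<in> S" and max: "\<forall>t \<in> S. ?N s \<subseteq> ?N t \<longrightarrow> ?N s = ?N t" by blast
  have "E s k" if k: "k \<in> K" for k
  proof (rule ccontr)
    assume nonadj: "\<not> E s k"
    obtain t where t: "t \<in> S" "E k t" using dom k by blast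
    then have "\<not> ?N s \<subseteq> ?N t" using max nonadj k sym[of k t] by blast
    then obtain l where l: "l \<in> K" "E s l" "\<not> E t l" by blast
    then have "E l k" using assms(6) k nonadj by (auto simp: pairwise_def)
    moreover have "\<not> E s t" "\<not> E l t" using assms(3) s t l sym[of l t] unfolding stable_set_def by blast+
    moreover have "s \<in> V" "l \<in> V" "k \<in> V" "t \<in> V" using assms(2,4) s t k l by auto
    ultimately show False using assms(1) l(2) nonadj t(2) unfolding P4_free_def by blast
  qed
  then show ?thesis using s by blast
qed

lemma P4_free_colorable:
  assumes "finite V" "P4_free E V" "cliques_le E V w"
  shows "colorable E V w"
  using assms
proof (induction w arbitrary: V)
  case 0
  then show ?case by (auto dest: cliques_le_0D simp: colorable_empty)
next
  case (Suc w)
  obtain S where S: "S \<subseteq> V" "stable_set E S" and dom: "\<And>v. v \<in> V - S \<Longrightarrow> \<exists>s \<in> S. E v s"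
    using obtain_dominating_stable[OF Suc.prems(1), of E] irrefl sym by metis
  have "cliques_le E (V - S) w"
    unfolding cliques_le_def
  proof (intro allI impI, rule ccontr)
    fix K assume K: "K \<subseteq> V - S" "pairwise E K" and large: "\<not> card K \<le> w"
    have "finite K" using K(1) Suc.prems(1) by (meson Diff_subset finite_subset)
    moreover have "K \<noteq> {}" using large by auto
    ultimately obtain s where s: "s \<in> S" "\<forall>k \<in> K. E s k"
      using P4_free_stable_extends_clique[OF Suc.prems(2) S, of K] K dom by blast
    then have "pairwise E (insert s K)" using K(2) sym by (auto simp: pairwise_insert)
    moreover have "insert s K \<subseteq> V" using K(1) S(1) s(1) by blast
    ultimately have "card (insert s K) \<le> Suc w" using Suc.prems(3) unfolding cliques_le_def by blast
    moreover have "s \<notin> K" using K(1) s(1) by blast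
    ultimately show False using \<open>finite K\<close> large by simp
  qed
  moreover have "P4_free E (V - S)" using Suc.prems(2) by (rule P4_free_subset) blast
  ultimately have "colorable E (V - S) w" using Suc.IH Suc.prems(1) by simp
  from colorable_Un[OF this colorable_stable[OF S(2)]] show ?case
    by (rule colorable_mono) (use S(1) in auto)
qed

lemma P4_plus_K1_free_colorable:
  assumes "finite V" "P4_plus_K1_free E V" "cliques_le E V w"
  shows "colorable E V (Suc w choose 2)"
  using assms
proof (induction w arbitrary: V)
  case 0
  then show ?case by (auto dest: cliques_le_0D simp: colorable_empty)
next
  case (Suc w)
  show ?case
  proof (cases "V = {}")
    case True
    then show ?thesis by (simp add: colorable_empty)
  next
    case False
    then obtain v where v: "v \<in> V" by blast
    let ?N = "{u \<in> V. E v u}" and ?M = "{u \<in> V. \<not> E v u}"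
    have "P4_plus_K1_free E ?N" using Suc.prems(2) by (rule P4_plus_K1_free_subset) auto
    then have N: "colorable E ?N (Suc w choose 2)"
      using Suc.IH[of ?N] Suc.prems cliques_le_neighbours[OF Suc.prems(1) v] by simp
    have "cliques_le E ?M (Suc w)" using Suc.prems(3) by (rule cliques_le_subset) auto
    moreover have "P4_free E ?M" using Suc.prems(2) v unfolding P4_plus_K1_free_def by blast
    ultimately have "colorable E ?M (Suc w)" using P4_free_colorable Suc.prems(1) by simp
    from colorable_Un[OF N this] have "colorable E (?N \<union> ?M) (Suc (Suc w) choose 2)"
      by (simp add: numeral_2_eq_2 ac_simps)
    then show ?thesis by (rule colorable_mono) auto
  qed
qed

lemma colorable_edge_step:
  assumes "finite V" "gem_plus_free E V" "cliques_le E V (Suc (Suc m))"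
    and uv: "u \<in> V" "v \<in> V" "E u v"
    and H: "colorable E {w \<in> V. \<not> E u w \<and> \<not> E v w} h"
  shows "colorable E V (h + (Suc m choose 2) + 2 * Suc m)"
proof -
  let ?N = "\<lambda>x. {w \<in> V. E x w}"
  have N: "P4_plus_K1_free E (?N x)" "cliques_le E (?N x) (Suc m)" if "x \<in> V" for x
    using assms(2) that cliques_le_neighbours[OF assms(1) that assms(3)] unfolding gem_plus_free_def by blast+
  have one_sided: "colorable E {w \<in> ?N x. \<not> E y w} (Suc m)" if xy: "x \<in> V" "y \<in> V" "E x y" for x y
  proof (rule P4_free_colorable)
    show "P4_free E {w \<in> ?N x. \<not> E y w}" using N(1)[of x] xy unfolding P4_plus_K1_free_def by blast
    show "cliques_le E {w \<in> ?N x. \<not> E y w} (Suc m)" using N(2)[of x] xy by (auto intro: cliques_le_subset)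
  qed (use assms(1) in simp)
  have "colorable E {w \<in> ?N u. E v w} (Suc m choose 2)"
  proof (rule P4_plus_K1_free_colorable)
    show "P4_plus_K1_free E {w \<in> ?N u. E v w}" using N(1)[OF uv(1)] by (rule P4_plus_K1_free_subset) auto
    show "cliques_le E {w \<in> ?N u. E v w} m" using cliques_le_neighbours[of "?N u" v m] N(2) uv assms(1) by simp
  qed (use assms(1) in simp)
  from colorable_Un[OF colorable_Un[OF H this] colorable_Un[OF one_sided[of u v] one_sided[of v u]]]
  have "colorable E ({w \<in> V. \<not> E u w \<and> \<not> E v w} \<union> {w \<in> ?N u. E v w} \<union>
      ({w \<in> ?N u. \<not> E v w} \<union> {w \<in> ?N v. \<not> E u w})) (h + (Suc m choose 2) + (Suc m + Suc m))"
    using uv sym by blast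
  then show ?thesis by (rule colorable_mono) auto
qed

lemma has_induced_matching_Suc:
  assumes "u \<in> V" "v \<in> V" "E u v" "has_induced_matching E {w \<in> V. \<not> E u w \<and> \<not> E v w} p"
  shows "has_induced_matching E V (Suc p)"
proof -
  obtain h where h: "\<And>m. m < 2 * p \<Longrightarrow> h m \<in> V \<and> \<not> E u (h m) \<and> \<not> E v (h m)"
    and adj: "\<And>m n. m < 2 * p \<Longrightarrow> n < 2 * p \<Longrightarrow> E (h m) (h n) \<longleftrightarrow> m div 2 = n div 2 \<and> m \<noteq> n"
    using assms(4) unfolding has_induced_matching_def by blast
  let ?h = "h(2 * p := u, 2 * p + 1 := v)"
  have cases: "m < 2 * p \<or> m = 2 * p \<or> m = 2 * p + 1" if "m < 2 * Suc p" for m using that by auto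
  have "?h m \<in> V" if "m < 2 * Suc p" for m using cases[OF that] h assms(1,2) by auto
  moreover have "E (?h m) (?h n) \<longleftrightarrow> m div 2 = n div 2 \<and> m \<noteq> n" if "m < 2 * Suc p" "n < 2 * Suc p" for m n
  proof -
    have "\<not> E (h m) u \<and> \<not> E (h m) v" if "m < 2 * p" for m using h[OF that] sym by blast
    moreover have "m div 2 \<noteq> p" if "m < 2 * p" for m using that by auto
    ultimately show ?thesis
      using cases[OF that(1)] cases[OF that(2)] h adj assms(3) sym[OF assms(3)] irrefl by (elim disjE) auto
  qed
  ultimately show ?thesis unfolding has_induced_matching_def by (intro exI[of _ ?h]) blast
qed

lemma has_induced_matching_0: "has_induced_matching E V 0"
  by (simp add: has_induced_matching_def)

lemma stable_if_no_induced_matching: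
  assumes "\<not> has_induced_matching E V 1"
  shows "stable_set E V"
  using assms has_induced_matching_Suc[OF _ _ _ has_induced_matching_0] unfolding stable_set_def One_nat_def
    by blast

lemma has_induced_matching_2I:
  assumes "a \<in> V" "b \<in> V" "c \<in> V" "d \<in> V" "E a b" "E c d"
    "\<not> E a c" "\<not> E a d" "\<not> E b c" "\<not> E b d"
  shows "has_induced_matching E V 2"
proof -
  have "has_induced_matching E {w \<in> V. \<not> E a w \<and> \<not> E b w} (Suc 0)"
    by (rule has_induced_matching_Suc[of c _ d]) (use assms has_induced_matching_0 in auto)
  then have "has_induced_matching E V (Suc (Suc 0))"
    by (rule has_induced_matching_Suc[rotated 3]) (use assms in auto)
  then show ?thesis by (simp add: numeral_2_eq_2)
qed

lemma colorable_Suc_induced_matching: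
  assumes "finite V" "gem_plus_free E V" "cliques_le E V (Suc (Suc m))"
    and "\<not> has_induced_matching E V (Suc p)"
    and "\<And>W. W \<subseteq> V \<Longrightarrow> \<not> has_induced_matching E W p \<Longrightarrow> colorable E W h"
  shows "colorable E V (h + (Suc m choose 2) + 2 * Suc m)"
proof (cases "stable_set E V")
  case True
  then show ?thesis by (intro colorable_mono[OF colorable_stable]) auto
next
  case False
  then obtain u v where uv: "u \<in> V" "v \<in> V" "E u v" unfolding stable_set_def by blast
  have "\<not> has_induced_matching E {w \<in> V. \<not> E u w \<and> \<not> E v w} p"
    using has_induced_matching_Suc[OF uv] assms(4) by blast
  then have "colorable E {w \<in> V. \<not> E u w \<and> \<not> E v w} h" by (intro assms(5)) auto
  then show ?thesis by (rule colorable_edge_step[OF assms(1-3) uv])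
qed

lemma colorable_if_2K2_free:
  assumes "finite V" "gem_plus_free E V" "cliques_le E V (Suc (Suc m))" "\<not> has_induced_matching E V 2"
  shows "colorable E V (Suc (Suc (Suc m)) choose 2)"
proof -
  have "colorable E W 1" if "\<not> has_induced_matching E W 1" for W
    using that by (intro colorable_stable stable_if_no_induced_matching)
  then have "colorable E V (1 + (Suc m choose 2) + 2 * Suc m)"
    by (intro colorable_Suc_induced_matching[where p = 1]) (use assms in \<open>simp_all add: numeral_2_eq_2\<close>)
  then show ?thesis by (simp add: numeral_2_eq_2 ac_simps)
qed

end

section \<open>\<open>2K\<^sub>2\<close>-free graphs with clique number three\<close>

locale two_K2_K4_gem_plus_free =
  fixes E :: "'a \<Rightarrow> 'a \<Rightarrow> bool"
  assumes commute: "E u v \<longleftrightarrow> E v u"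
    and two_K2_free: "E a b \<Longrightarrow> E c d \<Longrightarrow> E a c \<or> E a d \<or> E b c \<or> E b d"
    and K4_free: "\<not> (E a b \<and> E a c \<and> E a d \<and> E b c \<and> E b d \<and> E c d)"
    and gem_plus_free: "E h a \<Longrightarrow> E h b \<Longrightarrow> E h c \<Longrightarrow> E h d \<Longrightarrow> E h e \<Longrightarrow> E a b \<Longrightarrow> E b c \<Longrightarrow> E c d \<Longrightarrow>
      E a c \<or> E a d \<or> E b d \<or> E e a \<or> E e b \<or> E e c \<or> E e d"
begin

text \<open>All configurations of this section live in the complement, whose adjacency is \<open>N\<close>; there a
  colour class is a clique. Since \<open>N\<close> is reflexive, the vertices of a configuration
  need no separate treatment.\<close>

abbreviation N :: "'a \<Rightarrow> 'a \<Rightarrow> bool" where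
  "N u v \<equiv> \<not> E u v"

lemma N_if_common_N: "E c d \<Longrightarrow> N u c \<Longrightarrow> N u d \<Longrightarrow> N v c \<Longrightarrow> N v d \<Longrightarrow> N u v"
  using two_K2_free[of u v c d] by blast

lemma N_if_common_E: "E c d \<Longrightarrow> E u c \<Longrightarrow> E u d \<Longrightarrow> E v c \<Longrightarrow> E v d \<Longrightarrow> N u v"
  using K4_free[of u v c d] by blast

lemma N_gem:
  assumes "N m p" "N m q" "N m r" "N m s" "N p q" "N q r" "N r s" "E p r" "E p s" "E q s"
  shows "N z p \<or> N z q \<or> N z r \<or> N z s \<or> N z m"
  using assms gem_plus_free[of z q s p r m] commute by (smt (verit))

definition pentagon :: "'a \<Rightarrow> 'a \<Rightarrow> 'a \<Rightarrow> 'a \<Rightarrow> 'a \<Rightarrow> bool" where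
  "pentagon c0 c1 c2 c3 c4 \<longleftrightarrow> N c0 c1 \<and> N c1 c2 \<and> N c2 c3 \<and> N c3 c4 \<and> N c4 c0 \<and>
     E c0 c2 \<and> E c1 c3 \<and> E c2 c4 \<and> E c3 c0 \<and> E c4 c1"

definition hub :: "'a \<Rightarrow> 'a \<Rightarrow> 'a \<Rightarrow> 'a \<Rightarrow> 'a \<Rightarrow> 'a \<Rightarrow> bool" where
  "hub c0 c1 c2 c3 c4 w \<longleftrightarrow> N w c0 \<and> N w c1 \<and> N w c2 \<and> N w c3 \<and> N w c4"

definition pendant :: "'a \<Rightarrow> 'a \<Rightarrow> 'a \<Rightarrow> 'a \<Rightarrow> 'a \<Rightarrow> 'a \<Rightarrow> bool" where
  "pendant c0 c1 c2 c3 c4 w \<longleftrightarrow> N w c0 \<and> E w c1 \<and> E w c2 \<and> E w c3 \<and> E w c4"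

definition ear :: "'a \<Rightarrow> 'a \<Rightarrow> 'a \<Rightarrow> 'a \<Rightarrow> 'a \<Rightarrow> 'a \<Rightarrow> bool" where
  "ear c0 c1 c2 c3 c4 w \<longleftrightarrow> N w c0 \<and> N w c1 \<and> E w c2 \<and> E w c3 \<and> E w c4"

lemma pentagon_rotations:
  assumes "pentagon c0 c1 c2 c3 c4"
  shows "pentagon c1 c2 c3 c4 c0" "pentagon c2 c3 c4 c0 c1" "pentagon c3 c4 c0 c1 c2" "pentagon c4 c0 c1 c2 c3"
  using assms unfolding pentagon_def by blast+

lemma pentagon_reflect: "pentagon c0 c1 c2 c3 c4 \<Longrightarrow> pentagon c0 c4 c3 c2 c1"
  by (simp add: pentagon_def commute)

lemma pendant_reflect: "pendant c0 c1 c2 c3 c4 w \<Longrightarrow> pendant c0 c4 c3 c2 c1 w"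
  unfolding pendant_def by blast

lemma ear_reflect: "ear c0 c1 c2 c3 c4 w \<Longrightarrow> ear c1 c0 c4 c3 c2 w"
  unfolding ear_def by blast

lemma pentagon_between:
  assumes "pentagon c0 c1 c2 c3 c4"
  shows "N w c0 \<and> N w c2 \<longrightarrow> N w c1" "N w c1 \<and> N w c3 \<longrightarrow> N w c2" "N w c2 \<and> N w c4 \<longrightarrow> N w c3"
    "N w c3 \<and> N w c0 \<longrightarrow> N w c4" "N w c4 \<and> N w c1 \<longrightarrow> N w c0"
  using assms N_if_common_N[of c0 c2 w c1] N_if_common_N[of c1 c3 w c2] N_if_common_N[of c2 c4 w c3]
    N_if_common_N[of c3 c0 w c4] N_if_common_N[of c4 c1 w c0]
  unfolding pentagon_def using commute by (smt (verit))+

context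
  fixes c0 c1 c2 c3 c4 l f
  assumes pentagon: "pentagon c0 c1 c2 c3 c4" and pendant: "pendant c0 c1 c2 c3 c4 l"
    and ear: "ear c3 c4 c0 c1 c2 f"
begin

lemmas pendant_ear_config = pentagon[unfolded pentagon_def] pendant[unfolded pendant_def] ear[unfolded ear_def]

lemma pendant_adj_ear: "E l f"
  using N_if_common_N[of c0 f l c4] pendant_ear_config commute by (smt (verit))

lemma hub_N_pendant: "hub c0 c1 c2 c3 c4 w \<Longrightarrow> N w l"
  using N_gem[of w c1 c2 c3 c4 l] pendant_ear_config commute unfolding hub_def by (smt (verit))

lemma hub_N_ear:
  assumes "hub c0 c1 c2 c3 c4 w" "ear c3 c4 c0 c1 c2 v"
  shows "N w v"
  using assms N_gem[of w l c0 c1 c2 v] N_if_common_N[of c0 v l c4] hub_N_pendant[of w] pendant_ear_config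
    commute unfolding hub_def ear_def by (smt (verit))

lemma N_c2_if_N_pendant_ear: "N w c0 \<Longrightarrow> N w c4 \<Longrightarrow> N w f \<Longrightarrow> N w l \<Longrightarrow> N w c2"
  using N_gem[of w l c0 c4 f c2] pendant_ear_config pendant_adj_ear commute by (smt (verit))

lemma N_ear_if_opposite_pendant: "N w c2 \<Longrightarrow> N w c4 \<Longrightarrow> E w c0 \<Longrightarrow> E w c1 \<Longrightarrow> N w f"
  using N_if_common_N[of c0 w l c4] N_if_common_E[of c1 w l f] pentagon_between[OF pentagon, of w]
    pendant_ear_config pendant_adj_ear commute by (smt (verit))

lemma pendant_ear_stable_N_c3_ear:
  assumes u: "N u c3 \<and> N u f \<and> (N u c1 \<or> N u c4)" and v: "N v c3 \<and> N v f \<and> (N v c1 \<or> N v c4)"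
  shows "N u v"
proof -
  note between = pentagon_between[OF pentagon]
  have E_c2: "E w l \<and> N w c4 \<and> E w c1" if "N w c3 \<and> N w f \<and> (N w c1 \<or> N w c4)" "E w c2" for w
    using that between[of w] N_c2_if_N_pendant_ear[of w] N_if_common_N[of c0 w l c4] pendant_ear_config commute
    by (smt (verit))
  have mixed: "N u v"
    if u: "N u c3 \<and> N u f \<and> (N u c1 \<or> N u c4)" "N u c2"
      and v: "N v c3 \<and> N v f \<and> (N v c1 \<or> N v c4)" "E v c2" for u v
  proof (cases "N u c0")
    case True
    then have "hub c0 c1 c2 c3 c4 u" using u between[of u] unfolding hub_def by blast
    then have "N u v" if "ear c3 c4 c0 c1 c2 v" using hub_N_ear that by blast
    then show ?thesis
      using True u v E_c2[OF v] between[of v] N_if_common_N[of c0 c3 u v] pendant_ear_config commute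
      unfolding ear_def by (smt (verit))
  next
    case False
    then have "E u l"
      using u between[of u] N_if_common_N[of c0 u l c1] N_if_common_N[of c0 u l c4] pendant_ear_config commute
      by (smt (verit))
    then show ?thesis
      using u v N_gem[of c3 c2 u f v l] E_c2[OF v] pendant_ear_config pendant_adj_ear commute by (smt (verit))
  qed
  show ?thesis
    using u v mixed[of u v] mixed[of v u] E_c2[of u] E_c2[of v] N_if_common_N[of c2 f u v]
      N_if_common_E[of l c2 u v] pendant_ear_config commute by (smt (verit))
qed

lemma pendant_ear_stable_E_c2:
  assumes u: "E u c2 \<and> (E u c3 \<or> E u f) \<and> (N u c1 \<or> N u c4)"
    and v: "E v c2 \<and> (E v c3 \<or> E v f) \<and> (N v c1 \<or> N v c4)"
  shows "N u v"
proof -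
  note between = pentagon_between[OF pentagon]
  have N_c0: "N w c0" if "E w c2 \<and> (E w c3 \<or> E w f) \<and> (N w c1 \<or> N w c4)" for w
    using that between[of w] N_if_common_E[of c0 c2 w f] N_if_common_N[of c0 w l c1]
      N_if_common_N[of c0 w l c4] N_if_common_E[of c2 c4 l w] N_if_common_E[of c1 c3 l w]
      pendant_ear_config commute by (smt (verit))
  have N_f: "N w c1 \<and> N w c4 \<and> E w l \<and> E w c3"
    if "E w c2 \<and> (E w c3 \<or> E w f) \<and> (N w c1 \<or> N w c4)" "N w f" for w
    using that N_c0[of w] between[of w] N_if_common_N[of c0 f w c4] N_c2_if_N_pendant_ear[of w]
      N_if_common_E[of c1 c3 w l] pendant_ear_config commute by (smt (verit))
  have mixed: "N u v"
    if "E u c2 \<and> (E u c3 \<or> E u f) \<and> (N u c1 \<or> N u c4)" "N u f"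
      "E v c2 \<and> (E v c3 \<or> E v f) \<and> (N v c1 \<or> N v c4)" for u v
    using that N_f[of u] N_c0[of u] N_c0[of v] between[of v] N_if_common_E[of l c2 u v]
      N_gem[of c0 u c4 v l c2] N_gem[of c0 u c1 v l c3] pendant_ear_config commute by (smt (verit))
  show ?thesis
    using u v mixed[of u v] mixed[of v u] N_if_common_E[of c2 f u v] pendant_ear_config commute by blast
qed

lemma pendant_ear_stable_N_c2:
  assumes u: "N u c2 \<and> (E u c3 \<or> E u f) \<and> (N u c1 \<or> N u c4)"
    and v: "N v c2 \<and> (E v c3 \<or> E v f) \<and> (N v c1 \<or> N v c4)"
  shows "N u v"
proof -
  note between = pentagon_between[OF pentagon]
  have c1_f: "N w c1 \<and> E w f" if "N w c2 \<and> (E w c3 \<or> E w f) \<and> (N w c1 \<or> N w c4)" for w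
    using that between[of w] N_ear_if_opposite_pendant[of w] N_if_common_N[of c2 f w c3] pendant_ear_config
      commute by (smt (verit))
  have mixed: "N u v" if "N u c2" "N u c1" "E u f" "N u c0" "N v c2" "N v c1" "E v f" "E v c0" for u v
    using that N_gem[of c1 v c2 u c0 f] pendant_ear_config commute by (smt (verit))
  show ?thesis
    using u v mixed[of u v] mixed[of v u] c1_f[OF u] c1_f[OF v] N_if_common_N[of c0 c2 u v]
      N_if_common_E[of c0 f u v] pendant_ear_config commute by (smt (verit))
qed

lemma colorable_if_pendant_ear: "colorable E UNIV 4"
proof (rule colorable_4I)
  let ?A = "\<lambda>w. E w c1 \<and> E w c4" and ?B = "\<lambda>w. N w c3 \<and> N w f \<and> (N w c1 \<or> N w c4)"
  let ?C = "\<lambda>w. E w c2 \<and> (E w c3 \<or> E w f) \<and> (N w c1 \<or> N w c4)"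
  let ?D = "\<lambda>w. N w c2 \<and> (E w c3 \<or> E w f) \<and> (N w c1 \<or> N w c4)"
  show "?A w \<or> ?B w \<or> ?C w \<or> ?D w" for w by blast
  show "N u v" if "?A u" "?A v" for u v
    using N_if_common_E[of c1 c4 u v] that pendant_ear_config commute by blast
  show "N u v" if "?B u" "?B v" for u v using that by (rule pendant_ear_stable_N_c3_ear)
  show "N u v" if "?C u" "?C v" for u v using that by (rule pendant_ear_stable_E_c2)
  show "N u v" if "?D u" "?D v" for u v using that by (rule pendant_ear_stable_N_c2)
qed

end

lemma colorable_if_pendant_ear_reflected:
  assumes "pentagon c0 c1 c2 c3 c4" "pendant c0 c1 c2 c3 c4 l" "ear c1 c2 c3 c4 c0 f"
  shows "colorable E UNIV 4"
  using colorable_if_pendant_ear[OF pentagon_reflect pendant_reflect ear_reflect] assms by blast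

context
  fixes c0 c1 c2 c3 c4 f g
  assumes not_colorable: "\<not> colorable E UNIV 4" and pentagon: "pentagon c0 c1 c2 c3 c4"
    and ear_f: "ear c0 c1 c2 c3 c4 f" and ear_g: "ear c4 c0 c1 c2 c3 g" and f_adj_g: "E f g"
begin

lemmas adj_ears_config = pentagon[unfolded pentagon_def] ear_f[unfolded ear_def] ear_g[unfolded ear_def] f_adj_g

lemma adj_ears_no_pendant:
  assumes "pentagon d0 d1 d2 d3 d4" "ear d3 d4 d0 d1 d2 e \<or> ear d1 d2 d3 d4 d0 e"
  shows "\<not> pendant d0 d1 d2 d3 d4 w"
  using assms colorable_if_pendant_ear colorable_if_pendant_ear_reflected not_colorable by meson

lemma adj_ears_no_pendant_c1_c2_c3: "\<not> pendant c1 c2 c3 c4 c0 w" "\<not> pendant c2 c3 c4 c0 c1 w"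
    "\<not> pendant c3 c4 c0 c1 c2 w"
  using adj_ears_no_pendant[OF pentagon_rotations(1)[OF pentagon]]
    adj_ears_no_pendant[OF pentagon_rotations(2)[OF pentagon]]
    adj_ears_no_pendant[OF pentagon_rotations(3)[OF pentagon]] ear_f ear_g
  by blast+

lemma hub_N_remote_ear:
  assumes "hub c0 c1 c2 c3 c4 k" "ear c1 c2 c3 c4 c0 w"
  shows "N k w"
proof (cases "N k f")
  case True
  then show ?thesis
    using assms N_if_common_N[of c2 f k w] N_gem[of k c3 c4 c0 f w] adj_ears_config commute
    unfolding hub_def ear_def by (smt (verit))
next
  case False
  then have "E k g"
    using assms N_gem[of k g c4 c3 c2 f] adj_ears_config commute unfolding hub_def by (smt (verit))
  moreover have "E w g"
    using assms N_if_common_N[of c0 w g c1] adj_ears_config commute unfolding ear_def by (smt (verit))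
  ultimately show ?thesis
    using assms N_gem[of c4 g c0 k c3 w] adj_ears_config commute unfolding hub_def ear_def by (smt (verit))
qed

lemma adj_ears_stable_N_c1_c2:
  assumes u: "N u c1 \<and> N u c2" and v: "N v c1 \<and> N v c2"
  shows "N u v"
proof -
  note between = pentagon_between[OF pentagon]
  have hub: "N k w" if "N k c1 \<and> N k c2" "N w c1 \<and> N w c2" "N k c4" for k w
    using that between[of k] between[of w] hub_N_remote_ear[of k w] N_if_common_N[of c0 c2 k w]
      N_if_common_N[of c1 c3 k w] adj_ears_config commute unfolding hub_def ear_def by (smt (verit))
  have mixed: "N u v" if "N u c1 \<and> N u c2" "N v c1 \<and> N v c2" "E u c4" "E v c4" "E u f" "N v f" for u v
    using that N_gem[of c1 u c2 v f c4] adj_ears_config commute by (smt (verit))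
  show ?thesis
    using u v hub[of u v] hub[of v u] mixed[of u v] mixed[of v u] N_if_common_N[of c2 f u v]
      N_if_common_E[of c4 f u v] adj_ears_config commute by (smt (verit))
qed

lemma adj_ears_stable_N_c3:
  assumes u: "N u c3 \<and> (E u c1 \<or> E u c2) \<and> (N u c2 \<or> N u f)"
    and v: "N v c3 \<and> (E v c1 \<or> E v c2) \<and> (N v c2 \<or> N v f)"
  shows "N u v"
proof -
  note between = pentagon_between[OF pentagon]
  have N_c2: "E w f \<and> E w g \<and> E w c1 \<and> E w c0"
    if "N w c3 \<and> (E w c1 \<or> E w c2) \<and> (N w c2 \<or> N w f)" "N w c2" for w
    using that between[of w] N_if_common_N[of c1 w f c2] N_if_common_N[of c3 g w c4]
      N_if_common_N[of c4 w g c3] N_gem[of w g c4 c3 c2 f] adj_ears_config commute by (smt (verit))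
  have E_c2: "N w f \<and> E w c1 \<and> N w c4 \<and> N w c0"
    if "N w c3 \<and> (E w c1 \<or> E w c2) \<and> (N w c2 \<or> N w f)" "E w c2" for w
    using that between[of w] N_if_common_N[of c0 w f c4] adj_ears_no_pendant_c1_c2_c3(3)[of w]
      adj_ears_config commute unfolding pendant_def by (smt (verit))
  have mixed: "N u v"
    if u: "N u c3 \<and> (E u c1 \<or> E u c2) \<and> (N u c2 \<or> N u f)" "N u c2"
      and v: "N v c3 \<and> (E v c1 \<or> E v c2) \<and> (N v c2 \<or> N v f)" "E v c2" for u v
    using N_c2[OF u] E_c2[OF v] u v N_gem[of c0 c1 f v g u] N_if_common_E[of c1 g u v] adj_ears_config
      commute by (smt (verit))
  show ?thesis
    using u v mixed[of u v] mixed[of v u] N_c2[OF u] N_c2[OF v] E_c2[OF u] E_c2[OF v]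
      N_if_common_E[of f g u v] N_if_common_N[of c0 c3 u v] adj_ears_config commute by (smt (verit))
qed

lemma N_c0_c1_if_E_c2_c3_g:
  assumes w: "E w c2" "E w c3" "N w f" "E w g"
  shows "N w c0 \<and> N w c1 \<and> E w c4"
proof -
  have c1: "N w c1" using N_if_common_E[of c1 c3 w g] w adj_ears_config commute by blast
  have c0: "N w c0"
    using w c1 pentagon_between[OF pentagon, of w] adj_ears_no_pendant_c1_c2_c3(1)[of w] unfolding pendant_def
      by blast
  have "E w c4"
  proof (rule ccontr)
    assume "N w c4"
    then have "pentagon c4 w c1 c2 c3" "ear w c1 c2 c3 c4 f"
      using c0 c1 w adj_ears_config commute unfolding pentagon_def ear_def by blast+
    moreover have "pendant c4 w c1 c2 c3 g"
      using w adj_ears_config commute unfolding pendant_def by blast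
    ultimately show False using adj_ears_no_pendant by blast
  qed
  with c0 c1 show ?thesis by blast
qed

lemma adj_ears_stable_E_c3:
  assumes u: "E u c3 \<and> (E u c1 \<or> E u c2) \<and> (N u c2 \<or> N u f)"
    and v: "E v c3 \<and> (E v c1 \<or> E v c2) \<and> (N v c2 \<or> N v f)"
  shows "N u v"
proof -
  note between = pentagon_between[OF pentagon]
  have f_c2: "N w f \<and> E w c2" if "E w c3 \<and> (E w c1 \<or> E w c2) \<and> (N w c2 \<or> N w f)" for w
    using that between[of w] adj_ears_no_pendant_c1_c2_c3(2)[of w] unfolding pendant_def by (smt (verit))
  have mixed: "N u v"
    if u: "E u c3" "E u c2" "N u f" "E u g" and v: "E v c3" "E v c2" "N v f" "N v g" for u v
    using u v N_c0_c1_if_E_c2_c3_g[of u] between[of v] N_gem[of c0 u f v g c2] N_if_common_E[of c2 c4 u v]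
      N_if_common_N[of c0 v f c4] adj_ears_config commute by (smt (verit))
  show ?thesis
    using u v f_c2[OF u] f_c2[OF v] mixed[of u v] mixed[of v u] N_c0_c1_if_E_c2_c3_g[of u]
      N_c0_c1_if_E_c2_c3_g[of v] N_if_common_N[of f g u v] N_if_common_E[of c2 c4 u v] adj_ears_config commute
    by (smt (verit))
qed

lemma adj_ears_contradiction: False
proof -
  let ?A = "\<lambda>w. N w c1 \<and> N w c2" and ?B = "\<lambda>w. E w c2 \<and> E w f"
  let ?C = "\<lambda>w. N w c3 \<and> (E w c1 \<or> E w c2) \<and> (N w c2 \<or> N w f)"
  let ?D = "\<lambda>w. E w c3 \<and> (E w c1 \<or> E w c2) \<and> (N w c2 \<or> N w f)"
  have "colorable E UNIV 4"
  proof (rule colorable_4I)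
    show "?A w \<or> ?B w \<or> ?C w \<or> ?D w" for w by blast
    show "N u v" if "?A u" "?A v" for u v using that by (rule adj_ears_stable_N_c1_c2)
    show "N u v" if "?B u" "?B v" for u v
      using N_if_common_E[of c2 f u v] that adj_ears_config commute by blast
    show "N u v" if "?C u" "?C v" for u v using that by (rule adj_ears_stable_N_c3)
    show "N u v" if "?D u" "?D v" for u v using that by (rule adj_ears_stable_E_c3)
  qed
  with not_colorable show False ..
qed

end

context
  fixes c0 c1 c2 c3 c4 e
  assumes not_colorable: "\<not> colorable E UNIV 4" and pentagon: "pentagon c0 c1 c2 c3 c4"
    and ear: "ear c0 c1 c2 c3 c4 e"
begin

lemmas ear_config = pentagon[unfolded pentagon_def] ear[unfolded ear_def]

lemma ear_no_pendant_c2_c4: "\<not> pendant c2 c3 c4 c0 c1 w" "\<not> pendant c4 c0 c1 c2 c3 w"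
  using colorable_if_pendant_ear[OF pentagon_rotations(2)[OF pentagon] _ ear]
    colorable_if_pendant_ear_reflected[OF pentagon_rotations(4)[OF pentagon] _ ear] not_colorable
  by blast+

lemma ear_stable_N_c1_c2:
  assumes u: "N u c1 \<and> N u c2 \<and> (E u c4 \<or> N u e)" and v: "N v c1 \<and> N v c2 \<and> (E v c4 \<or> N v e)"
  shows "N u v"
proof -
  note between = pentagon_between[OF pentagon]
  have mixed: "N u v"
    if "N u c1 \<and> N u c2" "E u c4" "E u e" "N v c1 \<and> N v c2" "N v e" for u v
  proof (cases "N v c4")
    case True
    then show ?thesis
      using that between[of u] between[of v] N_if_common_N[of c0 c2 u v] N_if_common_N[of c1 c3 u v]
        N_gem[of v e c0 c4 c3 u] ear_config commute by (smt (verit))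
  next
    case False
    then show ?thesis using that N_gem[of c1 u c2 v e c4] ear_config commute by (smt (verit))
  qed
  show ?thesis
    using u v mixed[of u v] mixed[of v u] N_if_common_N[of c2 e u v] N_if_common_E[of c4 e u v] ear_config
      commute by (smt (verit))
qed

lemma ear_stable_remote:
  assumes "N u c3 \<and> E u e \<and> (N u c2 \<and> N u c4 \<or> ear c2 c3 c4 c0 c1 u \<or> ear c3 c4 c0 c1 c2 u)"
    and "N v c3 \<and> E v e \<and> (N v c2 \<and> N v c4 \<or> ear c2 c3 c4 c0 c1 v \<or> ear c3 c4 c0 c1 c2 v)"
  shows "N u v"
proof -
  have mixed: "N u v"
    if "N u c3 \<and> E u e" "N u c2 \<and> N u c4" "N v c3 \<and> E v e" "ear c2 c3 c4 c0 c1 v \<or> ear c3 c4 c0 c1 c2 v" for u v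
    using that N_gem[of c3 v c2 u c4 e] N_gem[of c3 v c4 u c2 e] ear_config commute
    unfolding ear_def by (smt (verit))
  have ears: "N u v" if "ear c3 c4 c0 c1 c2 u" "ear c2 c3 c4 c0 c1 v" for u v
    using adj_ears_contradiction[OF not_colorable pentagon_rotations(3)[OF pentagon] that] by blast
  have "N u v" if "ear c2 c3 c4 c0 c1 u" "ear c2 c3 c4 c0 c1 v"
    using that N_if_common_E[of c4 c1 u v] ear_config unfolding ear_def by blast
  moreover have "N u v" if "ear c3 c4 c0 c1 c2 u" "ear c3 c4 c0 c1 c2 v"
    using that N_if_common_E[of c0 c2 u v] ear_config unfolding ear_def by blast
  ultimately show ?thesis
    using assms mixed[of u v] mixed[of v u] ears[of u v] ears[of v u] N_if_common_N[of c2 c4 u v] ear_config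
      commute by (smt (verit))
qed

lemma ear_contradiction: False
proof -
  let ?A = "\<lambda>w. E w c2 \<and> E w c4" and ?B = "\<lambda>w. N w c1 \<and> N w c2 \<and> (E w c4 \<or> N w e)"
  let ?C = "\<lambda>w. N w c0 \<and> E w c2 \<and> N w c4"
  let ?D = "\<lambda>w. N w c3 \<and> E w e \<and> (N w c2 \<and> N w c4 \<or> ear c2 c3 c4 c0 c1 w \<or> ear c3 c4 c0 c1 c2 w)"
  have "colorable E UNIV 4"
  proof (rule colorable_4I)
    show "?A w \<or> ?B w \<or> ?C w \<or> ?D w" for w
    proof -
      have "E w e" if "N w c2" "E w c1" using that N_if_common_N[of c1 w e c2] ear_config commute by blast
      moreover have "E w e" if "N w c4" "E w c0" using that N_if_common_N[of c0 w e c4] ear_config commute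
        by blast
      ultimately show ?thesis
        using pentagon_between[OF pentagon, of w] ear_no_pendant_c2_c4[of w] unfolding pendant_def ear_def
          by (smt (verit))
    qed
    show "N u v" if "?A u" "?A v" for u v
      using N_if_common_E[of c2 c4 u v] that ear_config by blast
    show "N u v" if "?B u" "?B v" for u v using that by (rule ear_stable_N_c1_c2)
    show "N u v" if "?C u" "?C v" for u v
      using that N_gem[of c0 u c4 v e c2] N_gem[of c0 v c4 u e c2] N_if_common_N[of c4 e u v]
        N_if_common_E[of c2 e u v] ear_config commute by (smt (verit))
    show "N u v" if "?D u" "?D v" for u v using that by (rule ear_stable_remote)
  qed
  with not_colorable show False ..
qed

end

context
  fixes c0 c1 c2 c3 c4
  assumes not_colorable: "\<not> colorable E UNIV 4" and pentagon: "pentagon c0 c1 c2 c3 c4"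
begin

lemma pentagon_N_third:
  assumes "N w c0" "N w c1"
  shows "N w c2 \<or> N w c4"
proof (rule ccontr)
  assume not_thesis: "\<not> ?thesis"
  then have "E w c3" using assms pentagon_between(4)[OF pentagon, of w] by blast
  then have "ear c0 c1 c2 c3 c4 w" using assms not_thesis unfolding ear_def by blast
  then show False by (rule ear_contradiction[OF not_colorable pentagon])
qed

lemma pentagon_stable_N_c0_c1:
  assumes u: "N u c0 \<and> N u c1 \<and> E u c3" and v: "N v c0 \<and> N v c1 \<and> E v c3"
  shows "N u v"
proof -
  note edges = pentagon[unfolded pentagon_def]
  have third: "N w c4 \<and> E w c2 \<or> N w c2 \<and> E w c4" if "N w c0 \<and> N w c1 \<and> E w c3" for w
    using that pentagon_N_third[of w] pentagon_between[OF pentagon, of w] by argo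
  have mixed: "N u v"
    if "N u c0 \<and> N u c1 \<and> E u c3" "N v c0 \<and> N v c1 \<and> E v c3" "N u c4 \<and> E u c2" "N v c2 \<and> E v c4" for u v
  proof (rule ccontr)
    assume "\<not> N u v"
    then have "pentagon c1 c2 c3 c4 u" "ear c1 c2 c3 c4 u v"
      using that edges commute unfolding pentagon_def ear_def by blast+
    then show False by (rule ear_contradiction[OF not_colorable])
  qed
  show ?thesis
    using third[OF u] third[OF v] u v mixed[of u v] mixed[of v u] N_if_common_N[of c4 c1 u v]
      N_if_common_N[of c0 c2 u v] edges commute by (smt (verit))
qed

end

lemma colorable_if_pentagon:
  assumes pentagon: "pentagon c0 c1 c2 c3 c4"
  shows "colorable E UNIV 4"
proof (rule ccontr)
  assume not_colorable: "\<not> ?thesis"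
  note edges = pentagon[unfolded pentagon_def]
  note rotations = pentagon_rotations[OF pentagon]
  let ?A = "\<lambda>w. N w c0 \<and> N w c3" and ?B = "\<lambda>w. N w c0 \<and> N w c1 \<and> E w c3"
  let ?C = "\<lambda>w. N w c2 \<and> N w c3 \<and> E w c0"
  let ?D = "\<lambda>w. (E w c0 \<or> E w c1) \<and> (E w c1 \<or> E w c2) \<and> (E w c2 \<or> E w c3) \<and> (E w c3 \<or> E w c4) \<and>
    (E w c4 \<or> E w c0)"
  have "colorable E UNIV 4"
  proof (rule colorable_4I)
    show "?A w \<or> ?B w \<or> ?C w \<or> ?D w" for w
      using pentagon_N_third[OF not_colorable rotations(1), of w]
        pentagon_N_third[OF not_colorable rotations(3), of w]
        pentagon_N_third[OF not_colorable rotations(4), of w] by argo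
    show "N u v" if "?A u" "?A v" for u v
      using N_if_common_N[of c3 c0 u v] that edges by blast
    show "N u v" if "?B u" "?B v" for u v
      using that by (rule pentagon_stable_N_c0_c1[OF not_colorable pentagon])
    show "N u v" if "?C u" "?C v" for u v
      using that by (rule pentagon_stable_N_c0_c1[OF not_colorable rotations(2)])
    show "N u v" if "?D u" "?D v" for u v
      using N_if_common_E[of c0 c2 u v] N_if_common_E[of c1 c3 u v] N_if_common_E[of c2 c4 u v]
        N_if_common_E[of c3 c0 u v] N_if_common_E[of c4 c1 u v] that pentagon_between[OF pentagon, of u]
        pentagon_between[OF pentagon, of v] edges by (smt (verit))
  qed
  with not_colorable show False ..
qed

definition path5 :: "'a \<Rightarrow> 'a \<Rightarrow> 'a \<Rightarrow> 'a \<Rightarrow> 'a \<Rightarrow> bool" where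
  "path5 p1 p2 p3 p4 p5 \<longleftrightarrow> N p1 p2 \<and> N p2 p3 \<and> N p3 p4 \<and> N p4 p5 \<and>
     E p1 p3 \<and> E p1 p4 \<and> E p1 p5 \<and> E p2 p4 \<and> E p2 p5 \<and> E p3 p5"

lemma path5_reverse: "path5 p1 p2 p3 p4 p5 \<Longrightarrow> path5 p5 p4 p3 p2 p1"
  by (simp add: path5_def commute)

lemma path5_between:
  assumes "path5 p1 p2 p3 p4 p5"
  shows "N w p1 \<and> N w p3 \<longrightarrow> N w p2" "N w p2 \<and> N w p4 \<longrightarrow> N w p3" "N w p3 \<and> N w p5 \<longrightarrow> N w p4"
  using assms N_if_common_N[of p1 p3 w p2] N_if_common_N[of p2 p4 w p3] N_if_common_N[of p3 p5 w p4]
  unfolding path5_def using commute by (smt (verit))+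

lemma path5_stable_side:
  assumes path: "path5 p1 p2 p3 p4 p5" and no_pentagon: "\<And>c0 c1 c2 c3 c4. \<not> pentagon c0 c1 c2 c3 c4"
    and u: "E u p1" "N u p5" "N u p2 \<or> N u p4" and v: "E v p1" "N v p5" "N v p2 \<or> N v p4"
  shows "N u v"
proof -
  note edges = path[unfolded path5_def]
  have p4: "N w p4" if "N w p5" "N w p2 \<or> N w p4" for w
    using that path5_between[OF path, of w] no_pentagon[of w p2 p3 p4 p5] edges commute unfolding pentagon_def
      by (smt (verit))
  have mixed: "N u v" if "E u p1" "N u p5" "N u p4" "N u p3" "E v p1" "N v p5" "N v p4" "E v p3" for u v
    using that N_gem[of p4 p3 u p5 v p1] edges commute by (smt (verit))
  show ?thesis
    using u v p4[of u] p4[of v] mixed[of u v] mixed[of v u] N_if_common_N[of p3 p5 u v]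
      N_if_common_E[of p1 p3 u v] edges commute by (smt (verit))
qed

lemma path5_stable_ends:
  assumes path: "path5 p1 p2 p3 p4 p5" and no_pentagon: "\<And>c0 c1 c2 c3 c4. \<not> pentagon c0 c1 c2 c3 c4"
    and u: "E u p2 \<and> E u p4 \<and> (N u p1 \<or> N u p5) \<or> N u p1 \<and> N u p5"
    and v: "E v p2 \<and> E v p4 \<and> (N v p1 \<or> N v p5) \<or> N v p1 \<and> N v p5"
  shows "N u v"
proof -
  note edges = path[unfolded path5_def]
  have all: "N w p2 \<and> N w p3 \<and> N w p4" if "N w p1 \<and> N w p5" "N w p2 \<or> N w p4" for w
    using that path5_between[OF path, of w] no_pentagon[of w p2 p3 p4 p5] no_pentagon[of w p1 p2 p3 p4]
      edges commute
    unfolding pentagon_def by (smt (verit))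
  have mixed: "N u v"
    if "E u p2 \<and> E u p4 \<and> (N u p1 \<or> N u p5)" "E u p1 \<or> E u p5" "N v p1 \<and> N v p5" "N v p2 \<or> N v p4" for u v
    using that all[of v] path5_between[OF path, of u] N_gem[of v p1 p2 p3 p4 u] N_gem[of v p2 p3 p4 p5 u]
      edges commute
    by (smt (verit))
  show ?thesis
    using u v mixed[of u v] mixed[of v u] N_if_common_N[of p1 p5 u v] N_if_common_E[of p2 p4 u v] edges commute
    by (smt (verit))
qed

lemma colorable_if_path5:
  assumes path: "path5 p1 p2 p3 p4 p5"
  shows "colorable E UNIV 4"
proof (rule ccontr)
  assume not_colorable: "\<not> ?thesis"
  then have no_pentagon: "\<not> pentagon c0 c1 c2 c3 c4" for c0 c1 c2 c3 c4
    using colorable_if_pentagon by blast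
  let ?A = "\<lambda>w. E w p1 \<and> E w p5"
    and ?B = "\<lambda>w. E w p2 \<and> E w p4 \<and> (N w p1 \<or> N w p5) \<or> N w p1 \<and> N w p5"
    and ?C = "\<lambda>w. E w p1 \<and> N w p5 \<and> (N w p2 \<or> N w p4)"
    and ?D = "\<lambda>w. E w p5 \<and> N w p1 \<and> (N w p4 \<or> N w p2)"
  have "colorable E UNIV 4"
  proof (rule colorable_4I)
    show "?A w \<or> ?B w \<or> ?C w \<or> ?D w" for w by blast
    show "N u v" if "?A u" "?A v" for u v
      using N_if_common_E[of p1 p5 u v] that path unfolding path5_def by blast
    show "N u v" if "?B u" "?B v" for u v using that by (rule path5_stable_ends[OF path no_pentagon])
    show "N u v" if "?C u" "?C v" for u v
      using path5_stable_side[OF path no_pentagon, of u v] that by blast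
    show "N u v" if "?D u" "?D v" for u v
      using path5_stable_side[OF path5_reverse[OF path] no_pentagon, of u v] that by blast
  qed
  with not_colorable show False ..
qed

lemma colorable_if_triangle:
  assumes abc: "E a b" "E a c" "E b c"
  shows "colorable E UNIV 4"
proof (rule ccontr)
  assume not_colorable: "\<not> ?thesis"
  let ?Q = "\<lambda>w. N w a \<and> N w b \<or> N w a \<and> N w c \<or> N w b \<and> N w c"
  have "colorable E UNIV 4"
  proof (rule colorable_4I)
    show "E w a \<and> E w b \<or> E w a \<and> E w c \<or> E w b \<and> E w c \<or> ?Q w" for w by blast
    show "N u v" if "E u a \<and> E u b" "E v a \<and> E v b" for u v
      using N_if_common_E[of a b u v] that abc by blast
    show "N u v" if "E u a \<and> E u c" "E v a \<and> E v c" for u v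
      using N_if_common_E[of a c u v] that abc by blast
    show "N u v" if "E u b \<and> E u c" "E v b \<and> E v c" for u v
      using N_if_common_E[of b c u v] that abc by blast
    show "N u v" if "?Q u" "?Q v" for u v
    proof (rule ccontr)
      assume "\<not> N u v"
      then have "\<exists>x y z. path5 x u y v z"
        using that abc N_if_common_N[of a b u v] N_if_common_N[of a c u v] N_if_common_N[of b c u v] commute
        unfolding path5_def by (smt (verit))
      then show False using colorable_if_path5 not_colorable by blast
    qed
  qed
  with not_colorable show False ..
qed

end

section \<open>Triangle-free graphs without \<open>3K\<^sub>2\<close>\<close>

locale K3_three_K2_free =
  fixes E :: "'a \<Rightarrow> 'a \<Rightarrow> bool"
  assumes commute: "E u v \<longleftrightarrow> E v u"
    and triangle_free: "\<not> (E u v \<and> E u w \<and> E v w)"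
    and three_K2_free: "E a a' \<Longrightarrow> E b b' \<Longrightarrow> E c c' \<Longrightarrow> E a b \<or> E a b' \<or> E a' b \<or> E a' b' \<or>
      E a c \<or> E a c' \<or> E a' c \<or> E a' c' \<or> E b c \<or> E b c' \<or> E b' c \<or> E b' c'"
begin

definition far :: "'a \<Rightarrow> 'a \<Rightarrow> 'a \<Rightarrow> bool" where
  "far x y v \<longleftrightarrow> \<not> E v x \<and> \<not> E v y"

definition far_pentagon :: "'a \<Rightarrow> 'a \<Rightarrow> 'a \<Rightarrow> 'a \<Rightarrow> 'a \<Rightarrow> 'a \<Rightarrow> 'a \<Rightarrow> bool" where
  "far_pentagon c0 c1 c2 c3 c4 x y \<longleftrightarrow>
     E c0 c1 \<and> E c1 c2 \<and> E c2 c3 \<and> E c3 c4 \<and> E c4 c0 \<and> E x y \<and>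
     far x y c0 \<and> far x y c1 \<and> far x y c2 \<and> far x y c3 \<and> far x y c4"

lemma far_swap: "far x y = far y x"
  by (auto simp: far_def)

lemma far_pentagon_rotations:
  assumes "far_pentagon c0 c1 c2 c3 c4 x y"
  shows "far_pentagon c1 c2 c3 c4 c0 x y" "far_pentagon c2 c3 c4 c0 c1 x y" "far_pentagon c3 c4 c0 c1 c2 x y"
    "far_pentagon c4 c0 c1 c2 c3 x y"
  using assms unfolding far_pentagon_def by blast+

lemma far_pentagon_swap: "far_pentagon c0 c1 c2 c3 c4 x y \<Longrightarrow> far_pentagon c0 c1 c2 c3 c4 y x"
  unfolding far_pentagon_def far_swap[of x y] commute[of x y] .

text \<open>No two edges of the far part are independent, so an odd cycle there is a five-cycle.\<close>

lemma far_bipartite_if_no_pentagon: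
  assumes xy: "E x y" and no_pentagon: "\<And>c0 c1 c2 c3 c4. \<not> far_pentagon c0 c1 c2 c3 c4 x y"
  obtains p :: "'a \<Rightarrow> bool" where "\<And>u v. far x y u \<Longrightarrow> far x y v \<Longrightarrow> E u v \<Longrightarrow> p u \<noteq> p v"
proof (cases "\<exists>a b. far x y a \<and> far x y b \<and> E a b")
  case True
  then obtain a b where ab: "far x y a" "far x y b" "E a b" by blast
  let ?w = "\<lambda>z. \<exists>w. far x y w \<and> E w a \<and> E z w"
  let ?p = "\<lambda>v. E v a \<or> \<not> E v b \<and> \<not> ?w v"
  have "?p u \<noteq> ?p v" if uv: "far x y u" "far x y v" "E u v" for u v
  proof -
    have vu: "E v u" using uv(3) commute[of u v] by blast
    have near: "E u a \<or> E u b \<or> E v a \<or> E v b"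
      using three_K2_free[of u v a b x y] xy ab uv unfolding far_def by blast
    have five: False if "far x y z" "far x y w" "far x y w'" "E z w" "E z w'" "E w a" "E w' b" for z w w'
      using no_pentagon[of a w z w' b] that ab xy commute[of a w] commute[of w z] commute[of b a]
      unfolding far_pentagon_def by blast
    have "\<not> (E u a \<and> E v a)" "\<not> (E u b \<and> E v b)" "\<not> (E u a \<and> E u b)" "\<not> (E v a \<and> E v b)"
      using triangle_free[of u v a] triangle_free[of u v b] triangle_free[of u a b]
        triangle_free[of v a b] ab uv
      by blast+
    moreover have "?w v" if "E u a" using that uv vu by blast
    moreover have "?w u" if "E v a" using that uv by blast
    moreover have "\<not> ?w v" if "E u b" using five[of v _ u] that uv vu by blast
    moreover have "\<not> ?w u" if "E v b" using five[of u _ v] that uv by blast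
    ultimately show ?thesis using near by argo
  qed
  then show thesis by (rule that[of ?p])
next
  case False
  show thesis by (rule that[of "\<lambda>_. True"]) (use False in blast)
qed

lemma colorable_if_no_far_pentagon:
  assumes "E x y" and "\<And>c0 c1 c2 c3 c4. \<not> far_pentagon c0 c1 c2 c3 c4 x y"
  shows "colorable E UNIV 4"
proof -
  obtain p :: "'a \<Rightarrow> bool" where p: "\<And>u v. far x y u \<Longrightarrow> far x y v \<Longrightarrow> E u v \<Longrightarrow> p u \<noteq> p v"
    using far_bipartite_if_no_pentagon[OF assms] by blast
  show ?thesis
  proof (rule colorable_4I)
    show "E v x \<or> E v y \<or> far x y v \<and> p v \<or> far x y v \<and> \<not> p v" for v unfolding far_def by blast
    show "\<not> E u v" if "E u x" "E v x" for u v using that triangle_free[of u v x] by blast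
    show "\<not> E u v" if "E u y" "E v y" for u v using that triangle_free[of u v y] by blast
    show "\<not> E u v" if "far x y u \<and> p u" "far x y v \<and> p v" for u v using that p by blast
    show "\<not> E u v" if "far x y u \<and> \<not> p u" "far x y v \<and> \<not> p v" for u v using that p by blast
  qed
qed

text \<open>Given a far pentagon, the far part is a blow-up of it together with isolated vertices. Its five
  classes are \<open>between x y c4 c1\<close> (the twins of \<open>c0\<close>) and its rotations.\<close>

definition between :: "'a \<Rightarrow> 'a \<Rightarrow> 'a \<Rightarrow> 'a \<Rightarrow> 'a \<Rightarrow> bool" where
  "between x y a b v \<longleftrightarrow> far x y v \<and> E v a \<and> E v b"

definition isolated :: "'a \<Rightarrow> 'a \<Rightarrow> 'a \<Rightarrow> bool" where
  "isolated x y i \<longleftrightarrow> far x y i \<and> (\<forall>v. far x y v \<longrightarrow> \<not> E i v)"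

definition sees :: "'a \<Rightarrow> ('a \<Rightarrow> bool) \<Rightarrow> bool" where
  "sees v S \<longleftrightarrow> (\<exists>s. S s \<and> E v s)"

lemma between_swap: "between x y = between y x"
  by (auto simp: between_def far_swap[of x y] fun_eq_iff)

lemma far_pentagon_chords:
  assumes "far_pentagon c0 c1 c2 c3 c4 x y"
  shows "\<not> E c0 c2" "\<not> E c1 c3" "\<not> E c2 c4" "\<not> E c3 c0" "\<not> E c4 c1"
  using assms triangle_free unfolding far_pentagon_def by (metis commute)+

lemma adjacent_classes_complete:
  assumes pentagon: "far_pentagon c0 c1 c2 c3 c4 x y" and "between x y c4 c1 s" "between x y c0 c2 t"
  shows "E s t"
  using assms far_pentagon_chords[OF pentagon] three_K2_free[of s c4 t c2 x y] triangle_free[of s c1 c2]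
    triangle_free[of t c0 c4] commute
  unfolding far_pentagon_def between_def far_def by (smt (verit))

lemma far_between_or_isolated:
  assumes pentagon: "far_pentagon c0 c1 c2 c3 c4 x y" and v: "far x y v"
  shows "between x y c4 c1 v \<or> between x y c0 c2 v \<or> between x y c1 c3 v \<or> between x y c2 c4 v \<or>
    between x y c3 c0 v \<or> isolated x y v"
proof -
  note tri = triangle_free[of _ c0 c1] triangle_free[of _ c1 c2] triangle_free[of _ c2 c3]
    triangle_free[of _ c3 c4] triangle_free[of _ c4 c0]
  have "isolated x y v" if nonadj: "\<not> E v c0" "\<not> E v c1" "\<not> E v c2" "\<not> E v c3" "\<not> E v c4"
  proof -
    have "\<not> E v w" if w: "far x y w" for w
      using nonadj v w pentagon tri[of w] three_K2_free[of v w c0 c1 x y] three_K2_free[of v w c1 c2 x y]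
        three_K2_free[of v w c2 c3 x y] three_K2_free[of v w c3 c4 x y] three_K2_free[of v w c4 c0 x y] commute
      unfolding far_pentagon_def far_def by (smt (verit))
    then show ?thesis using v unfolding isolated_def by blast
  qed
  then show ?thesis
    using pentagon v far_pentagon_chords[OF pentagon] tri[of v] three_K2_free[of v c0 c2 c3 x y]
      three_K2_free[of v c1 c3 c4 x y] three_K2_free[of v c2 c4 c0 x y] three_K2_free[of v c3 c0 c1 x y]
      three_K2_free[of v c4 c1 c2 x y] commute
    unfolding far_pentagon_def between_def far_def by (smt (verit))
qed

lemma sees_misses_adjacent_classes:
  assumes pentagon: "far_pentagon c0 c1 c2 c3 c4 x y" and v: "sees v (between x y c0 c2)"
    and s: "between x y c4 c1 s \<or> between x y c1 c3 s"
  shows "\<not> E v s"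
proof -
  obtain u where u: "between x y c0 c2 u" "E v u" using v unfolding sees_def by blast
  then have "E u s"
    using s adjacent_classes_complete[OF pentagon]
      adjacent_classes_complete[OF far_pentagon_rotations(1)[OF pentagon]] commute by blast
  then show ?thesis using triangle_free u(2) by blast
qed

text \<open>The colour of the class of \<open>c0\<close> is also given to the neighbours of \<open>x\<close> that see both adjacent
  classes; the other neighbours of \<open>x\<close> take a colour of the remaining four classes, and those of
  \<open>y\<close> the fourth colour. This only fails at an isolated vertex \<open>i\<close> as below.\<close>

lemma colorable_or_blocked:
  assumes pentagon: "far_pentagon c0 c1 c2 c3 c4 x y" and "\<not> colorable E UNIV 4"
  obtains r i t where "E r x" "sees r (between x y c0 c2)" "sees r (between x y c3 c0)"
    "isolated x y i" "E i r" "E i t" "E t y"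
proof (rule ccontr)
  assume not_blocked: "\<not> thesis"
  let ?S0 = "between x y c4 c1" and ?S1 = "between x y c0 c2" and ?S2 = "between x y c1 c3"
    and ?S3 = "between x y c2 c4" and ?S4 = "between x y c3 c0"
  note misses = sees_misses_adjacent_classes[OF pentagon]
    far_pentagon_rotations[OF pentagon, THEN sees_misses_adjacent_classes]
  let ?R = "\<lambda>v. E v x \<and> sees v ?S1 \<and> sees v ?S4"
  let ?A = "\<lambda>v. ?S0 v \<or> ?R v \<or> isolated x y v \<and> (\<forall>r. ?R r \<longrightarrow> \<not> E v r)"
    and ?B = "\<lambda>v. E v y \<or> isolated x y v \<and> (\<forall>t. E t y \<longrightarrow> \<not> E v t)"
    and ?C = "\<lambda>v. ?S1 v \<or> ?S3 v \<or> E v x \<and> \<not> sees v ?S1 \<and> \<not> sees v ?S3"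
    and ?D = "\<lambda>v. ?S2 v \<or> ?S4 v \<or> E v x \<and> \<not> sees v ?S2 \<and> \<not> sees v ?S4"
  have "colorable E UNIV 4"
  proof (rule colorable_4I)
    show "?A v \<or> ?B v \<or> ?C v \<or> ?D v" for v
    proof (cases "far x y v")
      case True
      then show ?thesis using far_between_or_isolated[OF pentagon] not_blocked that[of _ v] by blast
    next
      case False
      then show ?thesis
        using misses(2-4)[of v] unfolding far_def sees_def by blast
    qed
    show "\<not> E u v" if "?A u" "?A v" for u v
    proof
      assume "E u v"
      moreover have "\<not> E r s" if "?R r" "?S0 s" for r s
        using misses(1) that by blast
      ultimately show False using that triangle_free[of u v x] triangle_free[of u v c1] commute
        unfolding isolated_def between_def by blast
    qed
    show "\<not> E u v" if "?B u" "?B v" for u v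
      using that triangle_free[of u v y] commute unfolding isolated_def by blast
    show "\<not> E u v" if "?C u" "?C v" for u v
      using that triangle_free[of u v x] triangle_free[of u v c2] commute unfolding sees_def between_def
        by blast
    show "\<not> E u v" if "?D u" "?D v" for u v
      using that triangle_free[of u v x] triangle_free[of u v c3] commute unfolding sees_def between_def
        by blast
  qed
  with assms(2) show False ..
qed

text \<open>The first index of the name of a class vertex refers to its neighbour among the \<open>r\<close> and \<open>s\<close>,
  the last one to its class.\<close>

context
  fixes c0 c1 c2 c3 c4 x y i t r0 r1 s0 s3 s4 r0_1 r0_4 r1_2 r1_0 s0_1 s0_4 s3_4 s3_2 s4_0 s4_3
  assumes pentagon: "far_pentagon c0 c1 c2 c3 c4 x y"
    and i: "isolated x y i" "E i r0" "E i t"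
    and side_x: "E r0 x" "E r1 x" and side_y: "E s0 y" "E s3 y" "E s4 y" "E t y"
    and classes: "between x y c4 c1 r1_0" "between x y c4 c1 s4_0" "between x y c0 c2 r0_1"
      "between x y c0 c2 s0_1" "between x y c1 c3 r1_2" "between x y c1 c3 s3_2" "between x y c2 c4 s4_3"
      "between x y c3 c0 r0_4" "between x y c3 c0 s0_4" "between x y c3 c0 s3_4"
    and class_nbr: "E r0 r0_1" "E r0 r0_4" "E r1 r1_2" "E r1 r1_0" "E s0 s0_1" "E s0 s0_4" "E s3 s3_4"
      "E s3 s3_2" "E s4 s4_0" "E s4 s4_3"
begin

lemmas blocked_classes_complete =
  adjacent_classes_complete[OF pentagon] far_pentagon_rotations[OF pentagon, THEN adjacent_classes_complete]
lemmas blocked_misses =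
  sees_misses_adjacent_classes[OF pentagon]
  far_pentagon_rotations[OF pentagon, THEN sees_misses_adjacent_classes]

lemma blocked_class_far:
  assumes "between x y c4 c1 s \<or> between x y c0 c2 s \<or> between x y c1 c3 s \<or> between x y c2 c4 s \<or>
    between x y c3 c0 s"
  shows "\<not> E s x" "\<not> E s y" "\<not> E i s"
  using assms i(1) commute unfolding between_def isolated_def far_def by auto

lemma blocked_class_adj: "E s4_0 s3_4" "E r1_0 s3_4" "E s3_2 s4_3" "E r1_0 s0_1" "E s4_3 s0_4" "E r0_1 r1_2"
  using classes blocked_classes_complete commute by blast+

lemma blocked_class_nonadj: "\<not> E s3_2 s4_0" "\<not> E r0_4 r1_2" "\<not> E s4_0 r1_2" "\<not> E s3_4 r1_2" "\<not> E s0_1 s4_3"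
    "\<not> E r1_0 s4_3" "\<not> E r1_0 s3_2" "\<not> E s4_3 r0_1" "\<not> E s0_4 r0_1" "\<not> E r1_2 s0_4"
  using classes triangle_free unfolding between_def by blast+

lemma blockers_miss:
  "between x y c4 c1 s \<or> between x y c1 c3 s \<or> between x y c2 c4 s \<Longrightarrow> \<not> E r0 s"
  "between x y c3 c0 s \<or> between x y c0 c2 s \<or> between x y c2 c4 s \<Longrightarrow> \<not> E r1 s"
  "between x y c4 c1 s \<or> between x y c1 c3 s \<or> between x y c2 c4 s \<Longrightarrow> \<not> E s0 s"
  "between x y c4 c1 s \<or> between x y c0 c2 s \<or> between x y c2 c4 s \<Longrightarrow> \<not> E s3 s"
  "between x y c0 c2 s \<or> between x y c1 c3 s \<or> between x y c3 c0 s \<Longrightarrow> \<not> E s4 s"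
  using classes class_nbr blocked_misses[of _ s] unfolding sees_def by blast+

lemma blockers_nonadj: "\<not> E r0 r1" "\<not> E s0 s3" "\<not> E s0 s4" "\<not> E s3 s4" "\<not> E t s0" "\<not> E t s3" "\<not> E t s4"
    "\<not> E r0 y" "\<not> E r1 y" "\<not> E s0 x" "\<not> E s3 x" "\<not> E s4 x" "\<not> E t x" "\<not> E r0 t" "\<not> E i x" "\<not> E i y"
proof -
  have "E x y" using pentagon unfolding far_pentagon_def by blast
  then show "\<not> E r0 r1" "\<not> E s0 s3" "\<not> E s0 s4" "\<not> E s3 s4" "\<not> E t s0" "\<not> E t s3" "\<not> E t s4"
    "\<not> E r0 y" "\<not> E r1 y" "\<not> E s0 x" "\<not> E s3 x" "\<not> E s4 x" "\<not> E t x" "\<not> E r0 t"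
    using i side_x side_y triangle_free commute by (metis (full_types))+
qed (use i(1) in \<open>auto simp: isolated_def far_def\<close>)

lemmas blocked_config = i side_x side_y class_nbr blocked_class_adj blocked_class_nonadj blocked_class_far
  classes blockers_miss blockers_nonadj

lemma blocked_s4_adj_r0: "E s4 r0"
proof (rule ccontr)
  assume nonadj: "\<not> E s4 r0"
  have s3: "E r0 s3"
    using three_K2_free[of x r0 s3_2 s3 s4_0 s4] nonadj blocked_config commute by (smt (verit))
  have r1: "E s4 r1"
    using three_K2_free[of r0_4 r0 y s4 r1_2 r1] nonadj blocked_config commute by (smt (verit))
  have "E i s4"
    using three_K2_free[of r1_0 s3_4 r0 i y s4] nonadj s3 r1 triangle_free blocked_config commute
      by (smt (verit))
  then show False
    using three_K2_free[of s4_0 s3_4 r0 i r1_2 r1] nonadj s3 r1 triangle_free blocked_config commute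
      by (smt (verit))
qed

lemma blocked_i_nonadj_s4: "\<not> E i s4"
  using blocked_s4_adj_r0 i triangle_free commute by blast

lemma blocked_i_nonadj_s0: "\<not> E i s0"
proof
  assume s0: "E i s0"
  have s3: "E i s3"
    using three_K2_free[of s3_2 s3 s0 i s4_0 s4] s0 blocked_i_nonadj_s4 blocked_config commute by (smt (verit))
  then have "E r1_0 s4"
    using three_K2_free[of r1_0 s0_1 s4_3 s4 s3 i] blocked_i_nonadj_s4 blocked_config commute by (smt (verit))
  then have s4: "\<not> E r1 s4" using class_nbr triangle_free commute by blast
  then have "E r1 s0"
    using three_K2_free[of x r1 s4_3 s4 s0_1 s0] blocked_config commute by (smt (verit))
  then have r1: "\<not> E i r1" using s0 triangle_free commute by blast
  then have "E r1 s3"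
    using three_K2_free[of x r1 s4_3 s4 s3 i] s3 s4 blocked_i_nonadj_s4 blocked_config commute by (smt (verit))
  then show False
    using three_K2_free[of s3_2 s4_3 r1_0 r1 r0 i] triangle_free[of r1 s3 s3_2] r1 blocked_config commute
    by (smt (verit))
qed

lemma blocked_t_nonadj_s4_0: "\<not> E t s4_0"
proof
  assume s4_0: "E t s4_0"
  have t: "\<not> E t s" if "between x y c0 c2 s \<or> between x y c3 c0 s" for s
    using blocked_misses(5)[of t s] s4_0 classes that unfolding sees_def by blast
  have "E s0 r0"
    using three_K2_free[of s3_2 s4_3 y s0 r0 i] blocked_i_nonadj_s0 blocked_config commute by (smt (verit))
  then have nbr: "\<not> E r0 s0_4" "\<not> E s0 r0_1" using class_nbr triangle_free commute by blast+
  then have "E t s4_3"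
    using three_K2_free[of s4_3 s0_4 r0_1 r0 y t] t blocked_config commute by (smt (verit))
  then have "\<not> E t r1_2"
    using blocked_misses(3)[of t r1_2] classes unfolding sees_def by blast
  then show False
    using three_K2_free[of r0_1 r1_2 i t s0_4 s0] t nbr blocked_i_nonadj_s0 blocked_config commute
      by (smt (verit))
qed

lemma blocked_contradiction: False
proof -
  have "\<not> E i s3"
    using three_K2_free[of s0_1 s0 s4_3 s4 s3 i] blocked_i_nonadj_s0 blocked_i_nonadj_s4 blocked_config commute
      by (smt (verit))
  then have "E t s3_2"
    using three_K2_free[of s3_2 s3 s4_0 s4 i t] blocked_i_nonadj_s4 blocked_t_nonadj_s4_0 blocked_config commute
      by (smt (verit))
  then have "\<not> E t s0_1" "\<not> E t s4_3"
    using blocked_misses(2)[of t] classes unfolding sees_def by blast+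
  then show False
    using three_K2_free[of s0_1 s0 i t s4_3 s4] blocked_i_nonadj_s0 blocked_i_nonadj_s4 blocked_config commute
      by (smt (verit))
qed

end

lemma colorable_if_far_pentagon:
  assumes pentagon: "far_pentagon c0 c1 c2 c3 c4 x y"
  shows "colorable E UNIV 4"
proof (rule ccontr)
  assume not_colorable: "\<not> ?thesis"
  note swapped = far_pentagon_swap[OF pentagon]
  note rotations = far_pentagon_rotations[OF pentagon]
    and swapped_rotations = far_pentagon_rotations[OF swapped]
  obtain r0 i t where r0: "E r0 x" "sees r0 (between x y c0 c2)" "sees r0 (between x y c3 c0)"
    and i: "isolated x y i" "E i r0" "E i t" "E t y"
    by (rule colorable_or_blocked[OF pentagon not_colorable])
  obtain r1 where r1: "E r1 x" "sees r1 (between x y c1 c3)" "sees r1 (between x y c4 c1)"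
    by (rule colorable_or_blocked[OF rotations(1) not_colorable])
  obtain s0 where s0: "E s0 y" "sees s0 (between x y c0 c2)" "sees s0 (between x y c3 c0)"
    by (rule colorable_or_blocked[OF swapped not_colorable, unfolded between_swap[of y x]])
  obtain s3 where s3: "E s3 y" "sees s3 (between x y c3 c0)" "sees s3 (between x y c1 c3)"
    by (rule colorable_or_blocked[OF swapped_rotations(3) not_colorable, unfolded between_swap[of y x]])
  obtain s4 where s4: "E s4 y" "sees s4 (between x y c4 c1)" "sees s4 (between x y c2 c4)"
    by (rule colorable_or_blocked[OF swapped_rotations(4) not_colorable, unfolded between_swap[of y x]])
  show False
    using r0(2,3) r1(2,3) s0(2,3) s3(2,3) s4(2,3)
      blocked_contradiction[OF pentagon i(1-3) r0(1) r1(1) s0(1) s3(1) s4(1) i(4)]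
    unfolding sees_def by (elim exE conjE) blast
qed

lemma colorable_4: "colorable E UNIV 4"
proof (cases "\<exists>x y. E x y")
  case True
  then show ?thesis using colorable_if_far_pentagon colorable_if_no_far_pentagon by metis
next
  case False
  then have "stable_set E UNIV" unfolding stable_set_def by blast
  then show ?thesis by (intro colorable_mono[OF colorable_stable]) auto
qed

end

section \<open>The bound\<close>

context ugraph
begin

lemma two_K2_K4_gem_plus_free_induced:
  assumes "\<not> has_induced_matching E V 2" "gem_plus_free E V" "cliques_le E V 3"
  shows "two_K2_K4_gem_plus_free (induced E V)"
proof
  show "induced E V u v \<longleftrightarrow> induced E V v u" for u v using sym unfolding induced_def by blast
  show "induced E V a c \<or> induced E V a d \<or> induced E V b c \<or> induced E V b d"
    if "induced E V a b" "induced E V c d" for a b c d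
    using that has_induced_matching_2I[of a V b c d] assms(1) unfolding induced_def by blast
  show "\<not> (induced E V a b \<and> induced E V a c \<and> induced E V a d \<and> induced E V b c \<and>
      induced E V b d \<and> induced E V c d)"
    for a b c d
    using length_le_if_sorted_wrt[OF assms(3), of "[a, b, c, d]"] unfolding induced_def by auto
  show "induced E V a c \<or> induced E V a d \<or> induced E V b d \<or>
      induced E V e a \<or> induced E V e b \<or> induced E V e c \<or> induced E V e d"
    if "induced E V h a" "induced E V h b" "induced E V h c" "induced E V h d" "induced E V h e"
      "induced E V a b" "induced E V b c" "induced E V c d" for h a b c d e
  proof (rule ccontr)
    assume not_thesis: "\<not> ?thesis"
    have "P4_free E {w \<in> {w \<in> V. E h w}. \<not> E e w}"
      using assms(2) that unfolding gem_plus_free_def P4_plus_K1_free_def induced_def by blast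
    moreover have "{a, b, c, d} \<subseteq> {w \<in> {w \<in> V. E h w}. \<not> E e w}" using not_thesis that unfolding induced_def by auto
    ultimately have "P4_free E {a, b, c, d}" by (rule P4_free_subset)
    then show False using not_thesis that unfolding P4_free_def induced_def by blast
  qed
qed

lemma colorable_4_if_2K2_free:
  assumes "finite V" "gem_plus_free E V" "cliques_le E V 3" "\<not> has_induced_matching E V 2"
  shows "colorable E V 4"
proof (cases "\<exists>a \<in> V. \<exists>b \<in> V. \<exists>c \<in> V. E a b \<and> E a c \<and> E b c")
  case True
  then obtain a b c where "induced E V a b" "induced E V a c" "induced E V b c" unfolding induced_def by blast
  then have "colorable (induced E V) UNIV 4"
    by (rule two_K2_K4_gem_plus_free.colorable_if_triangle[OF two_K2_K4_gem_plus_free_induced[OF assms(4,2,3)]])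
  then show ?thesis by (rule colorable_induced)
next
  case False
  then have "cliques_le E V 2" by (intro cliques_le_2I) blast
  then have "colorable E V 3" using colorable_if_2K2_free[of V 0] assms by (simp add: numeral_eq_Suc)
  then show ?thesis by (rule colorable_mono) auto
qed

lemma K3_three_K2_free_induced:
  assumes "\<not> has_induced_matching E V 3" "cliques_le E V 2"
  shows "K3_three_K2_free (induced E V)"
proof
  show "induced E V u v \<longleftrightarrow> induced E V v u" for u v using sym unfolding induced_def by blast
  show "\<not> (induced E V u v \<and> induced E V u w \<and> induced E V v w)" for u v w
    using length_le_if_sorted_wrt[OF assms(2), of "[u, v, w]"] unfolding induced_def by auto
  show "induced E V a b \<or> induced E V a b' \<or> induced E V a' b \<or> induced E V a' b' \<or>
      induced E V a c \<or> induced E V a c' \<or> induced E V a' c \<or> induced E V a' c' \<or>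
      induced E V b c \<or> induced E V b c' \<or> induced E V b' c \<or> induced E V b' c'"
    if "induced E V a a'" "induced E V b b'" "induced E V c c'" for a a' b b' c c'
  proof (rule ccontr)
    assume not_thesis: "\<not> ?thesis"
    have "has_induced_matching E {w \<in> V. \<not> E a w \<and> \<not> E a' w} 2"
      by (rule has_induced_matching_2I[of b _ b' c c']) (use not_thesis that in \<open>simp_all add: induced_def\<close>)
    then have "has_induced_matching E V (Suc 2)"
      by (rule has_induced_matching_Suc[rotated 3]) (use that in \<open>simp_all add: induced_def\<close>)
    then show False using assms(1) by simp
  qed
qed

lemma colorable_4_if_3K2_free:
  assumes "\<not> has_induced_matching E V 3" "cliques_le E V 2"
  shows "colorable E V 4"
  by (rule colorable_induced[OF K3_three_K2_free.colorable_4[OF K3_three_K2_free_induced[OF assms]]])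

lemma colorable_chi_bound_le_1:
  assumes "2 \<le> p" "cliques_le E V m" "m \<le> 1"
  shows "colorable E V (chi_bound p m)"
proof (cases "m = 0")
  case True
  then show ?thesis using assms(2) by (auto dest: cliques_le_0D simp: colorable_empty)
next
  case False
  then have m: "m = 1" using assms(3) by simp
  have "stable_set E V"
    using length_le_if_sorted_wrt[OF assms(2), of "[u, v]" for u v] unfolding m stable_set_def by auto
  then show ?thesis using assms(1) m colorable_stable by (simp add: chi_bound_eqs(1)[simplified])
qed

lemma colorable_chi_bound_2:
  assumes "finite V" "gem_plus_free E V" "cliques_le E V m" "\<not> has_induced_matching E V 2" "2 \<le> m"
  shows "colorable E V (chi_bound 2 m)"
proof -
  obtain k where k: "m = Suc (Suc k)" using assms(5) by (metis add_2_eq_Suc le_Suc_ex)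
  have choose: "colorable E V (Suc m choose 2)" using colorable_if_2K2_free[of V k] assms k by simp
  consider "m = 2" | "m = 3" | "4 \<le> m" using assms(5) by linarith
  then show ?thesis
  proof cases
    case 1 then show ?thesis using choose by (simp add: chi_bound_eqs choose_two)
  next
    case 2 then show ?thesis using colorable_4_if_2K2_free assms by (simp add: chi_bound_eqs)
  next
    case 3 then show ?thesis using choose by (simp add: chi_bound_eqs)
  qed
qed

lemma chi_bound_step_le:
  assumes "2 \<le> p" "3 \<le> Suc (Suc k) \<or> 3 \<le> p"
  shows "chi_bound p (Suc (Suc k)) + (Suc k choose 2) + 2 * Suc k \<le> chi_bound (Suc p) (Suc (Suc k))"
proof (cases "k = 0")
  case True
  then show ?thesis
    using assms chi_bound_eqs(5)[of p] chi_bound_eqs(5)[of "Suc p"] by (simp add: numeral_2_eq_2)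
next
  case False
  then show ?thesis
    using assms chi_bound_eqs(6)[of "Suc (Suc k)" "Suc p"] by (simp add: numeral_2_eq_2)
qed

lemma colorable_chi_bound:
  assumes "2 \<le> p" "finite V" "gem_plus_free E V" "cliques_le E V m" "\<not> has_induced_matching E V p"
  shows "colorable E V (chi_bound p m)"
  using assms
proof (induction p arbitrary: V rule: dec_induct)
  case base
  then show ?case using colorable_chi_bound_le_1[of 2 V m] colorable_chi_bound_2[of V m] by linarith
next
  case (step p)
  consider "m \<le> 1" | "p = 2" "m = 2" | "2 \<le> m" "3 \<le> m \<or> 3 \<le> p"
    using step.hyps(1) by linarith
  then show ?case
  proof cases
    case 1
    then show ?thesis using colorable_chi_bound_le_1[of "Suc p"] step by simp
  next
    case 2
    then have "Suc p = 3" by simp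
    then show ?thesis using colorable_4_if_3K2_free[of V] step.prems 2 by (simp add: chi_bound_eqs)
  next
    case 3
    then obtain k where k: "m = Suc (Suc k)" by (metis add_2_eq_Suc le_Suc_ex)
    have "colorable E W (chi_bound p m)" if "W \<subseteq> V" "\<not> has_induced_matching E W p" for W
      using step that by (auto intro: step.IH finite_subset gem_plus_free_subset cliques_le_subset)
    then have "colorable E V (chi_bound p m + (Suc k choose 2) + 2 * Suc k)"
      using colorable_Suc_induced_matching[of V k p] step.prems k by blast
    then show ?thesis
      by (rule colorable_mono) (use chi_bound_step_le[of p k] step.hyps(1) 3(2) k in auto)
  qed
qed

end

lemma ugraph_parcs:
  assumes "pair_graph G"
  shows "ugraph (\<lambda>u v. (u, v) \<in> parcs G)"
proof -
  interpret G: pair_graph G by (rule assms)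
  show ?thesis by unfold_locales (use G.arcs_symmetric G.no_loops' in blast)+
qed

lemma parcs_disjoint_edges:
  "(m, n) \<in> parcs (disjoint_edges p) \<longleftrightarrow> m < 2 * p \<and> n < 2 * p \<and> m div 2 = n div 2 \<and> m \<noteq> n"
proof
  assume "(m, n) \<in> parcs (disjoint_edges p)"
  then show "m < 2 * p \<and> n < 2 * p \<and> m div 2 = n div 2 \<and> m \<noteq> n"
    by (auto simp: disjoint_edges_def symcl_def)
next
  assume *: "m < 2 * p \<and> n < 2 * p \<and> m div 2 = n div 2 \<and> m \<noteq> n"
  then have "m = 2 * (m div 2) \<and> n = 2 * (m div 2) + 1 \<or> n = 2 * (m div 2) \<and> m = 2 * (m div 2) + 1"
    by presburger
  moreover have "m div 2 < p" using * by auto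
  ultimately show "(m, n) \<in> parcs (disjoint_edges p)"
    unfolding disjoint_edges_def symcl_def by (force simp: image_iff)
qed

lemma no_induced_matching_if_free_of:
  assumes G: "pair_graph G" and \<F>: "\<And>F. F \<in> \<F> \<Longrightarrow> pair_graph F" and "free_of \<F> G"
    and "disjoint_edges p \<in> \<F>"
  shows "\<not> has_induced_matching (\<lambda>u v. (u, v) \<in> parcs G) (pverts G) p"
proof
  let ?E = "\<lambda>u v. (u, v) \<in> parcs G" and ?F = "disjoint_edges p"
  interpret ugraph ?E using G by (rule ugraph_parcs)
  have pverts: "pverts ?F = {..<2 * p}" by (simp add: disjoint_edges_def)
  assume "has_induced_matching ?E (pverts G) p"
  then obtain h where h: "\<And>m. m < 2 * p \<Longrightarrow> h m \<in> pverts G"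
    and adj: "\<And>m n. m < 2 * p \<Longrightarrow> n < 2 * p \<Longrightarrow> ?E (h m) (h n) \<longleftrightarrow> m div 2 = n div 2 \<and> m \<noteq> n"
    unfolding has_induced_matching_def by blast
  have "inj_on h {..<2 * p}"
  proof (rule inj_onI, rule ccontr)
    fix m n assume mn: "m \<in> {..<2 * p}" "n \<in> {..<2 * p}" "h m = h n" "m \<noteq> n"
    obtain k where k: "k < 2 * p" "k div 2 = m div 2" "k \<noteq> m"
    proof
      let ?k = "if even m then m + 1 else m - 1"
      show "?k < 2 * p" "?k div 2 = m div 2" "?k \<noteq> m" using mn(1) by (auto elim: oddE)
    qed
    then have "?E (h n) (h k)" using adj[of m k] mn by simp
    then have "?E (h m) (h n)" using adj[of n k] adj[of m n] k mn by simp
    then show False using mn(3) irrefl by simp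
  qed
  moreover have "h ` {..<2 * p} \<subseteq> pverts G" using h by auto
  moreover have "\<forall>m \<in> {..<2 * p}. \<forall>n \<in> {..<2 * p}. ?E (h m) (h n) \<longleftrightarrow> (m, n) \<in> parcs ?F"
    using adj by (simp add: parcs_disjoint_edges)
  ultimately show False
    using free_of_iff_embedding[OF G \<F>] assms(3,4) unfolding pverts[symmetric] by blast
qed

lemma gem_plus_free_if_free_of:
  assumes G: "pair_graph G" and \<F>: "\<And>F. F \<in> \<F> \<Longrightarrow> pair_graph F" and "free_of \<F> G"
    and "gem_plus \<in> \<F>"
  shows "gem_plus_free (\<lambda>u v. (u, v) \<in> parcs G) (pverts G)"
  unfolding gem_plus_free_def P4_plus_K1_free_def P4_free_def
proof (intro ballI impI, rule ccontr)
  let ?E = "\<lambda>u v. (u, v) \<in> parcs G"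
  interpret ugraph ?E using G by (rule ugraph_parcs)
  fix h e a b c d
  assume V: "h \<in> pverts G" "e \<in> {w \<in> pverts G. ?E h w}"
    "a \<in> {w \<in> {w \<in> pverts G. ?E h w}. \<not> ?E e w}" "b \<in> {w \<in> {w \<in> pverts G. ?E h w}. \<not> ?E e w}"
    "c \<in> {w \<in> {w \<in> pverts G. ?E h w}. \<not> ?E e w}" "d \<in> {w \<in> {w \<in> pverts G. ?E h w}. \<not> ?E e w}"
    and path: "?E a b" "?E b c" "?E c d" "\<not> (?E a c \<or> ?E a d \<or> ?E b d)"
  let ?f = "\<lambda>n::nat. if n = 0 then h else if n = 1 then a else if n = 2 then b else if n = 3 then c
    else if n = 4 then d else e"
  have adj: "?E h a" "?E h b" "?E h c" "?E h d" "?E h e" "\<not> ?E e a" "\<not> ?E e b" "\<not> ?E e c" "\<not> ?E e d"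
    using V by auto
  have rev_adj: "?E a h" "?E b h" "?E c h" "?E d h" "?E e h" "\<not> ?E a e" "\<not> ?E b e" "\<not> ?E c e" "\<not> ?E d e"
    "?E b a" "?E c b" "?E d c" "\<not> ?E c a" "\<not> ?E d a" "\<not> ?E d b"
    using adj path sym by blast+
  have distinct: "distinct [h, a, b, c, d, e]"
    using adj rev_adj path irrefl by auto
  have "inj_on ?f (pverts gem_plus)"
    using distinct by (auto simp: gem_plus_def inj_on_def)
  moreover have "?f ` pverts gem_plus \<subseteq> pverts G"
    using V by (auto simp: gem_plus_def)
  moreover have "\<forall>u \<in> pverts gem_plus. \<forall>v \<in> pverts gem_plus. ?E (?f u) (?f v) \<longleftrightarrow> (u, v) \<in> parcs gem_plus"
    using adj rev_adj path irrefl by (simp add: gem_plus_def symcl_def)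
  ultimately show False
    using free_of_iff_embedding[OF G \<F>] assms(3,4) by blast
qed

lemma cliques_le_clique_number:
  assumes "pair_graph G"
  shows "cliques_le (\<lambda>u v. (u, v) \<in> parcs G) (pverts G) (clique_number G)"
proof -
  interpret G: pair_graph G by (rule assms)
  have "finite {K. is_clique G K}"
    by (rule finite_subset[of _ "Pow (pverts G)"]) (auto simp: is_clique_def)
  then have "card K \<le> Max (card ` {K. is_clique G K})" if "is_clique G K" for K
    using that by (intro Max_ge) auto
  then show ?thesis unfolding cliques_le_def clique_number_def is_clique_def by blast
qed

lemma chromatic_number_le:
  assumes "pair_graph G" and "colorable (\<lambda>u v. (u, v) \<in> parcs G) (pverts G) k"
  shows "chromatic_number G \<le> k"
proof -
  interpret G: pair_graph G by (rule assms(1))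
  obtain c where c: "\<forall>v \<in> pverts G. c v < k"
    "\<forall>u \<in> pverts G. \<forall>v \<in> pverts G. (u, v) \<in> parcs G \<longrightarrow> c u \<noteq> c v"
    using assms(2) unfolding colorable_def by blast
  have "proper_coloring G k c"
    unfolding proper_coloring_def using c G.wellformed' by (auto simp: image_subset_iff)
  then show ?thesis unfolding chromatic_number_def by (blast intro: Least_le)
qed

theorem theorem3p9:
  fixes p :: nat and G :: "'a pair_pre_digraph"
  assumes "2 \<le> p"
    and "pair_graph G"
    and "free_of {disjoint_edges p, gem_plus} G"
  shows "chromatic_number G \<le> chi_bound p (clique_number G)"
proof (rule chromatic_number_le[OF assms(2)])
  let ?E = "\<lambda>u v. (u, v) \<in> parcs G"
  have F: "pair_graph F" if "F \<in> {disjoint_edges p, gem_plus}" for F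
    using that pair_graph_disjoint_edges pair_graph_gem_plus by blast
  interpret G: pair_graph G by (rule assms(2))
  have "finite (pverts G)" using G.finite_verts by simp
  moreover have "gem_plus_free ?E (pverts G)"
    by (rule gem_plus_free_if_free_of[OF assms(2) F assms(3)]) auto
  moreover have "\<not> has_induced_matching ?E (pverts G) p"
    by (rule no_induced_matching_if_free_of[OF assms(2) F assms(3)]) auto
  ultimately show "colorable ?E (pverts G) (chi_bound p (clique_number G))"
    using ugraph.colorable_chi_bound[OF ugraph_parcs[OF assms(2)] assms(1)]
      cliques_le_clique_number[OF assms(2)] by blast
qed

end
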